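(* Let $n\geq 3$, $0<\alpha<1$, and let $\Omega\subset\mathbb{R}^n$ be a bounded domain of class $C^{2+\alpha}$, with hyperbolic radius $v_\Omega$. Let $d(x)$ be the distance from $x$ to $\partial\Omega$ and let $w:=(v_\Omega-2d)/d^2$. Then $w$ and $d^2\nabla w$ are bounded near $\partial\Omega$, i.e. bounded on $\{x\in\Omega: 0<d(x)<\delta\}$ for some $\delta>0$.
   Context: The hyperbolic radius is $v_\Omega=u_\Omega^{-2/(n-2)}$, where the maximal solution $u_\Omega$ is the positive, smooth (in the interior of $\Omega$) solution of $-\Delta u+n(n-2)u^{\frac{n+2}{n-2}}=0$ in $\Omega$ which dominates all classical solutions; it is known to exist, and it is the limit as $m\to\infty$ of the increasing sequence $(u_m)_{m\ge1}$ of solutions of this equation equal to $m$ on $\partial\Omega$. The distance function $d$ is of class $C^{2+\alpha}$ near $\partial\Omega$. *)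

theory Defs
  imports "HOL-Analysis.Analysis"
begin

definition pderiv_at :: "'a::euclidean_space \<Rightarrow> ('a \<Rightarrow> real) \<Rightarrow> 'a \<Rightarrow> real"
  where "pderiv_at b f x = frechet_derivative f (at x) b"

definition gradient :: "('a::euclidean_space \<Rightarrow> real) \<Rightarrow> 'a \<Rightarrow> 'a"
  where "gradient f x = (\<Sum>b\<in>Basis. pderiv_at b f x *\<^sub>R b)"

definition laplacian :: "('a::euclidean_space \<Rightarrow> real) \<Rightarrow> 'a \<Rightarrow> real"
  where "laplacian f x = (\<Sum>b\<in>Basis. pderiv_at b (pderiv_at b f) x)"

(* Both regularity classes below are meant for open sets U: derivatives at points of U are
   full derivatives, not derivatives within U. *)

primrec Ck_on :: "nat \<Rightarrow> ('a::euclidean_space \<Rightarrow> real) \<Rightarrow> 'a set \<Rightarrow> bool"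
  where
    "Ck_on 0 f U \<longleftrightarrow> continuous_on U f"
  | "Ck_on (Suc k) f U \<longleftrightarrow>
       (\<forall>x\<in>U. f differentiable (at x)) \<and> (\<forall>b\<in>Basis. Ck_on k (pderiv_at b f) U)"

definition smooth_on :: "('a::euclidean_space \<Rightarrow> real) \<Rightarrow> 'a set \<Rightarrow> bool"
  where "smooth_on f U \<longleftrightarrow> (\<forall>k. Ck_on k f U)"

(* The class C^{k+alpha}(U), with partial derivatives of order k uniformly alpha-Hoelder on U. *)

primrec Ck_Holder_on :: "nat \<Rightarrow> real \<Rightarrow> ('a::euclidean_space \<Rightarrow> real) \<Rightarrow> 'a set \<Rightarrow> bool"
  where
    "Ck_Holder_on 0 \<alpha> f U \<longleftrightarrow>
       (\<exists>C. \<forall>x\<in>U. \<forall>y\<in>U. \<bar>f x - f y\<bar> \<le> C * dist x y powr \<alpha>)"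
  | "Ck_Holder_on (Suc k) \<alpha> f U \<longleftrightarrow>
       (\<forall>x\<in>U. f differentiable (at x)) \<and> (\<forall>b\<in>Basis. Ck_Holder_on k \<alpha> (pderiv_at b f) U)"

(* Near each boundary point, in suitably rotated Cartesian coordinates, the domain is the region
   above the graph of a C^{k+alpha} function g of n - 1 variables.  The unit vector e is the
   direction of the last rotated coordinate; instead of choosing the other n - 1 coordinate axes,
   g is given as a function on the whole space that does not depend on the e-coordinate. *)

definition bounded_domain_of_class :: "nat \<Rightarrow> real \<Rightarrow> 'a::euclidean_space set \<Rightarrow> bool"
  where "bounded_domain_of_class k \<alpha> \<Omega> \<longleftrightarrow>
    open \<Omega> \<and> connected \<Omega> \<and> \<Omega> \<noteq> {} \<and> bounded \<Omega> \<and>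
    (\<forall>p\<in>frontier \<Omega>. \<exists>r>0. \<exists>e g.
        norm e = 1 \<and> (\<forall>x t. g (x + t *\<^sub>R e) = g x) \<and> Ck_Holder_on k \<alpha> g (ball p r) \<and>
        \<Omega> \<inter> ball p r = {x \<in> ball p r. g x < x \<bullet> e})"

(* Loewner-Nirenberg equation; solutions are positive, so that the real power is meaningful. *)

definition classical_solution :: "'a::euclidean_space set \<Rightarrow> ('a \<Rightarrow> real) \<Rightarrow> bool"
  where "classical_solution \<Omega> u \<longleftrightarrow>
    Ck_on 2 u \<Omega> \<and> (\<forall>x\<in>\<Omega>. u x > 0) \<and>
    (let n = real DIM('a)
     in \<forall>x\<in>\<Omega>. - laplacian u x + n * (n - 2) * u x powr ((n + 2) / (n - 2)) = 0)"

definition maximal_solution :: "'a::euclidean_space set \<Rightarrow> ('a \<Rightarrow> real) \<Rightarrow> bool"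
  where "maximal_solution \<Omega> u \<longleftrightarrow>
    smooth_on u \<Omega> \<and> classical_solution \<Omega> u \<and>
    (\<forall>z. classical_solution \<Omega> z \<longrightarrow> (\<forall>x\<in>\<Omega>. z x \<le> u x))"

(* The maximal solution, hence the hyperbolic radius, is determined on \<Omega> only;
   the values of v outside \<Omega> are irrelevant. *)

definition hyperbolic_radius :: "'a::euclidean_space set \<Rightarrow> ('a \<Rightarrow> real) \<Rightarrow> bool"
  where "hyperbolic_radius \<Omega> v \<longleftrightarrow>
    (\<exists>u. maximal_solution \<Omega> u \<and> (\<forall>x\<in>\<Omega>. v x = u x powr (- 2 / (real DIM('a) - 2))))"

end

theory Submission
  imports Defs
begin

text \<open>
  Write \<open>n\<close> for the dimension. Differentiating \<open>w = (v - 2 d) / d\<^sup>2\<close> gives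
  \<open>d\<^sup>2 \<nabla>w = \<nabla>v - 2 \<nabla>d - 2 ((v - 2 d) / d) \<nabla>d\<close>. So it is enough to prove near the boundary that
  \<open>|v - 2 d| \<le> d\<^sup>2 / R\<close> for some \<open>R > 0\<close>, that \<open>d\<close> is differentiable (its gradient is then bounded by 1)
  and that \<open>\<nabla>v\<close> is bounded. All three facts follow from one geometric property of the domain: for
  some \<open>R\<close>, every boundary point is touched by a ball of radius \<open>R\<close> from inside and by one from outside.
  The regularity class provides it because the graph functions have bounded second derivatives and
  the boundary is compact (\<open>uniform_two_sided_ball\<close>).

  The bound on \<open>v - 2 d\<close> comes from the explicit solutions inside a ball and outside a ball. Inside
  the interior ball, the maximal solution is at most the explicit one, which blows up at the sphere;
  on \<open>\<Omega>\<close> it is at least the explicit solution outside the exterior ball, by maximality. At distance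
  \<open>d\<close> from the touching point, along the normal, the hyperbolic radii of the two explicit solutions
  are \<open>2 d - d\<^sup>2 / R\<close> and \<open>2 d + d\<^sup>2 / R\<close> (\<open>hyperbolic_radius_estimate\<close>).

  The function \<open>d\<close> is squeezed between the distances to the sphere of the interior ball and to the
  touching point, which have equal values and derivatives there (\<open>infdist_frontier_has_derivative\<close>).

  The bound on \<open>\<nabla>v\<close> is a scaling argument. On the ball of radius \<open>d / 2\<close> about a point at distance \<open>d\<close>,
  the first estimate bounds \<open>u\<close> by a multiple of \<open>d powr (- (n - 2) / 2)\<close> and, through the equation,
  the Laplacian of \<open>u\<close> by a multiple of \<open>d powr (- (n + 2) / 2)\<close>. An interior gradient estimate
  for the Laplace operator, proved with the maximum principle alone (\<open>directional_derivative_estimate\<close>),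
  bounds \<open>\<nabla>u\<close> by a multiple of \<open>d powr (- n / 2)\<close>, and \<open>\<nabla>v = - 2 / (n - 2) u powr (- n / (n - 2)) \<nabla>u\<close>
  is then bounded, since \<open>u powr (- n / (n - 2))\<close> is of order \<open>d powr (n / 2)\<close>.
\<close>

section \<open>Derivatives along lines and the comparison principle\<close>

lemma pderiv_at_eqI: "(f has_derivative D) (at x) \<Longrightarrow> pderiv_at b f x = D b"
  unfolding pderiv_at_def by (metis frechet_derivative_at)

lemma has_derivative_along_line:
  fixes f :: "'a::euclidean_space \<Rightarrow> real"
  assumes "f differentiable (at (x + s *\<^sub>R b))"
  shows "((\<lambda>s. f (x + s *\<^sub>R b)) has_real_derivative pderiv_at b f (x + s *\<^sub>R b)) (at s)"
proof -
  define D where "D = frechet_derivative f (at (x + s *\<^sub>R b))"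
  have D: "(f has_derivative D) (at (x + s *\<^sub>R b))"
    using assms frechet_derivative_works D_def by blast
  interpret bounded_linear D by (rule has_derivative_bounded_linear[OF D])
  have "((\<lambda>s. x + s *\<^sub>R b) has_derivative (\<lambda>h. h *\<^sub>R b)) (at s)"
    by (auto intro!: derivative_eq_intros)
  from diff_chain_at[OF this D] have "((\<lambda>s. f (x + s *\<^sub>R b)) has_derivative (\<lambda>h. h * D b)) (at s)"
    by (simp add: o_def scaleR)
  moreover have "(\<lambda>h. h * D b) = (*) (D b)" by (simp add: fun_eq_iff mult.commute)
  ultimately show ?thesis
    unfolding has_field_derivative_def pderiv_at_def D_def[symmetric] by simp
qed

text \<open>
  Applied along coordinate lines, this test serves as the maximum principle, because only pure second
  derivatives occur in the Laplacian.
\<close>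
lemma second_derivative_nonpos_at_max:
  fixes h :: "real \<Rightarrow> real"
  assumes "\<epsilon> > 0" and h: "\<And>s. \<bar>s\<bar> < \<epsilon> \<Longrightarrow> (h has_real_derivative h' s) (at s)"
    and h': "(h' has_real_derivative D) (at 0)"
    and max: "\<And>s. \<bar>s\<bar> < \<epsilon> \<Longrightarrow> h s \<le> h 0"
  shows "D \<le> 0"
proof (rule ccontr)
  assume "\<not> D \<le> 0"
  have h0: "h' 0 = 0"
    by (rule DERIV_local_max[OF h[of 0], of \<epsilon>]) (use assms in auto)
  have "D > 0" using \<open>\<not> D \<le> 0\<close> by simp
  from has_real_derivative_pos_inc_right[OF h' this]
  obtain d where d: "d > 0" "\<And>t. 0 < t \<Longrightarrow> t < d \<Longrightarrow> h' t > 0"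
    unfolding h0 by auto
  define t where "t = min d \<epsilon> / 2"
  have t: "0 < t" "t < d" "t < \<epsilon>" using d(1) assms(1) by (auto simp: t_def)
  obtain z where "0 < z" "z < t" "h t - h 0 = (t - 0) * h' z"
    using MVT2[OF t(1), of h h'] t h by (metis abs_of_nonneg le_less_trans)
  moreover have "h' z > 0" using d(2)[of z] t calculation(1,2) by linarith
  ultimately have "h t > h 0" using t by (metis diff_gt_0_iff_gt diff_zero mult_pos_pos)
  then show False using max[of t] t by auto
qed

lemma pderiv_at_eq_gradient:
  fixes f :: "'a::euclidean_space \<Rightarrow> real"
  assumes "f differentiable (at x)"
  shows "pderiv_at z f x = gradient f x \<bullet> z"
proof -
  interpret bounded_linear "frechet_derivative f (at x)"
    using assms frechet_derivative_works has_derivative_bounded_linear by blast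
  have "frechet_derivative f (at x) z = frechet_derivative f (at x) (\<Sum>b\<in>Basis. (z \<bullet> b) *\<^sub>R b)"
    by (simp only: euclidean_representation)
  also have "\<dots> = (\<Sum>b\<in>Basis. frechet_derivative f (at x) b * (b \<bullet> z))"
    by (simp add: sum scaleR mult.commute inner_commute)
  also have "\<dots> = gradient f x \<bullet> z"
    by (simp add: gradient_def pderiv_at_def inner_sum_left)
  finally show ?thesis by (simp only: pderiv_at_def)
qed

lemma norm_gradient_le:
  fixes f :: "'a::euclidean_space \<Rightarrow> real"
  assumes "\<And>b. b \<in> Basis \<Longrightarrow> \<bar>c * pderiv_at b f x\<bar> \<le> C"
  shows "norm (c *\<^sub>R gradient f x) \<le> real DIM('a) * C"
proof -
  have "c *\<^sub>R gradient f x = (\<Sum>b\<in>Basis. (c * pderiv_at b f x) *\<^sub>R b)"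
    by (simp add: gradient_def scaleR_sum_right)
  also have "norm \<dots> \<le> (\<Sum>b\<in>(Basis::'a set). C)"
    using assms by (intro order_trans[OF norm_sum] sum_mono) simp
  finally show ?thesis by simp
qed

lemma Ck_on_2D:
  assumes "Ck_on 2 f U" "x \<in> U"
  shows "f differentiable (at x)" "b \<in> Basis \<Longrightarrow> pderiv_at b f differentiable (at x)"
  using assms by (auto simp: numeral_2_eq_2)

lemma Ck_on_2_continuous: "Ck_on 2 f U \<Longrightarrow> continuous_on U f"
  by (meson Ck_on_2D(1) continuous_at_imp_continuous_on differentiable_imp_continuous_within)

lemma Ck_on_subset: "Ck_on k f U \<Longrightarrow> V \<subseteq> U \<Longrightarrow> Ck_on k f V"
  by (induction k arbitrary: f) (auto intro: continuous_on_subset)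

lemma classical_solution_subset: "classical_solution U f \<Longrightarrow> V \<subseteq> U \<Longrightarrow> classical_solution V f"
  unfolding classical_solution_def Let_def by (auto intro: Ck_on_subset)

text \<open>
  At a positive interior maximum of \<open>u - z\<close> the Laplacian of the difference would be at most 0,
  against the hypothesis on the Laplacians. The compact set \<open>K\<close> replaces boundary values: it
  allows \<open>z\<close> to blow up at the boundary of \<open>U\<close>.
\<close>
lemma comparison_principle:
  fixes u z :: "'a::euclidean_space \<Rightarrow> real"
  assumes "open U" and u: "Ck_on 2 u U" and z: "Ck_on 2 z U"
    and lap: "\<And>x. x \<in> U \<Longrightarrow> z x < u x \<Longrightarrow> laplacian z x < laplacian u x"
    and K: "compact K" "K \<subseteq> U" "\<And>x. x \<in> U - K \<Longrightarrow> u x \<le> z x"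
    and "x \<in> U"
  shows "u x \<le> z x"
proof (rule ccontr)
  assume neg: "\<not> u x \<le> z x"
  then have "x \<in> K" using K(3) \<open>x \<in> U\<close> by auto
  have cont: "continuous_on K (\<lambda>y. u y - z y)"
    using Ck_on_2_continuous[OF u] Ck_on_2_continuous[OF z] K(2)
    by (intro continuous_on_diff) (auto intro: continuous_on_subset)
  then obtain y where y: "y \<in> K" "\<And>y'. y' \<in> K \<Longrightarrow> u y' - z y' \<le> u y - z y"
    using continuous_attains_sup[OF K(1) _ cont] \<open>x \<in> K\<close> by blast
  have pos: "u y - z y > 0" using y(2)[OF \<open>x \<in> K\<close>] neg by auto
  \<comment> \<open>Outside \<open>K\<close> the difference is at most 0 and at \<open>y\<close> it is positive, so the
      maximum over \<open>K\<close> is a maximum over the open set \<open>U\<close>, hence a local one.\<close>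
  have ymax: "u y' - z y' \<le> u y - z y" if "y' \<in> U" for y'
    using y(2)[of y'] K(3)[of y'] that pos by force
  have "y \<in> U" using y K by auto
  then obtain \<epsilon> where \<epsilon>: "\<epsilon> > 0" "ball y \<epsilon> \<subseteq> U" using \<open>open U\<close> openE by blast
  have "pderiv_at b (pderiv_at b u) y - pderiv_at b (pderiv_at b z) y \<le> 0" if b: "b \<in> Basis" for b
  proof (rule second_derivative_nonpos_at_max[OF \<epsilon>(1)])
    have inU: "y + s *\<^sub>R b \<in> U" if "\<bar>s\<bar> < \<epsilon>" for s
      using \<epsilon>(2) that b by (auto simp: subset_eq dist_norm)
    show "((\<lambda>s. u (y + s *\<^sub>R b) - z (y + s *\<^sub>R b)) has_real_derivative
        pderiv_at b u (y + s *\<^sub>R b) - pderiv_at b z (y + s *\<^sub>R b)) (at s)" if "\<bar>s\<bar> < \<epsilon>" for s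
      by (intro DERIV_diff has_derivative_along_line Ck_on_2D(1)[OF u] Ck_on_2D(1)[OF z] inU that)
    show "((\<lambda>s. pderiv_at b u (y + s *\<^sub>R b) - pderiv_at b z (y + s *\<^sub>R b)) has_real_derivative
        pderiv_at b (pderiv_at b u) y - pderiv_at b (pderiv_at b z) y) (at 0)"
      using DERIV_diff[OF has_derivative_along_line[of "pderiv_at b u" y 0 b]
          has_derivative_along_line[of "pderiv_at b z" y 0 b]]
        Ck_on_2D(2)[OF u \<open>y \<in> U\<close> b] Ck_on_2D(2)[OF z \<open>y \<in> U\<close> b] by simp
    show "u (y + s *\<^sub>R b) - z (y + s *\<^sub>R b) \<le> u (y + 0 *\<^sub>R b) - z (y + 0 *\<^sub>R b)" if "\<bar>s\<bar> < \<epsilon>" for s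
      using ymax[OF inU[OF that]] by simp
  qed
  then have "laplacian u y - laplacian z y \<le> 0"
    unfolding laplacian_def sum_subtractf[symmetric] by (intro sum_nonpos) auto
  then show False using lap[OF \<open>y \<in> U\<close>] pos by auto
qed

section \<open>Explicit solutions and comparison with balls\<close>

text \<open>
  The explicit solutions attached to the sphere of radius \<open>R\<close> about \<open>c\<close>. For \<open>\<sigma> = - 1\<close> it is the
  maximal solution inside the ball, the conformal factor of the Poincare metric; for \<open>\<sigma> = 1\<close> it
  is the solution outside the ball that inversion in the sphere produces. Their powers of exponent
  \<open>- 2 / (n - 2)\<close> are \<open>(R\<^sup>2 - |x - c|\<^sup>2) / R\<close> and \<open>(|x - c|\<^sup>2 - R\<^sup>2) / R\<close>.
\<close>
definition ball_solution :: "real \<Rightarrow> 'a::euclidean_space \<Rightarrow> real \<Rightarrow> 'a \<Rightarrow> real"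
  where "ball_solution \<sigma> c R x =
    (R / (\<sigma> * ((norm (x - c))\<^sup>2 - R\<^sup>2))) powr ((real DIM('a) - 2) / 2)"

lemma classical_solution_ball_solution:
  fixes c :: "'a::euclidean_space"
  assumes dim: "DIM('a) \<ge> 3" and "\<bar>\<sigma>\<bar> = 1" and "R > 0"
    and sub: "U \<subseteq> {x. \<sigma> * ((norm (x - c))\<^sup>2 - R\<^sup>2) > 0}"
  shows "classical_solution U (ball_solution \<sigma> c R)"
proof -
  define n k where "n = real DIM('a)" and "k = (n - 2) / 2"
  have n: "n \<ge> 3" using dim by (simp add: n_def)
  have k: "k > 0" "k + 1 = n / 2" using n unfolding k_def by (simp_all add: diff_divide_distrib)
  define a where "a x = \<sigma> * ((norm (x - c))\<^sup>2 - R\<^sup>2)" for x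
  define V where "V = {x. a x > 0}"
  have "open V" unfolding V_def a_def by (intro open_Collect_less continuous_intros)
  have UV: "U \<subseteq> V" using sub by (simp add: V_def a_def)
  have \<sigma>2: "\<sigma> * \<sigma> = 1" using assms(2) by (metis abs_mult_self_eq mult_1)
  have da: "(a has_derivative (\<lambda>h. 2 * \<sigma> * ((x - c) \<bullet> h))) (at x)" for x
    unfolding a_def power2_norm_eq_inner
    by (auto intro!: derivative_eq_intros simp: inner_commute algebra_simps)
  have dp: "((\<lambda>x. a x powr m) has_derivative (\<lambda>h. m * a x powr (m - 1) * (2 * \<sigma> * ((x - c) \<bullet> h)))) (at x)"
    if "x \<in> V" for x m
  proof -
    have "((\<lambda>t. t powr m) has_derivative (*) (m * a x powr (m - 1))) (at (a x))"
      using has_real_derivative_powr[of "a x" m] that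
      unfolding has_field_derivative_def V_def by simp
    from diff_chain_at[OF da this] show ?thesis by (simp add: o_def)
  qed
  define F where "F x = R powr k * a x powr (- k)" for x
  define F1 where "F1 b x = R powr k * (- k * a x powr (- k - 1) * (2 * \<sigma> * ((x - c) \<bullet> b)))" for b x
  define F2 where "F2 b b' x = R powr k * (4 * k * (k + 1) * a x powr (- k - 2) * ((x - c) \<bullet> b) * ((x - c) \<bullet> b')
    - 2 * k * \<sigma> * a x powr (- k - 1) * (b \<bullet> b'))" for b b' x
  have F: "(F has_derivative (\<lambda>h. F1 h x)) (at x)" if "x \<in> V" for x
    unfolding F_def F1_def by (intro has_derivative_mult_right dp that)
  have F1: "(F1 b has_derivative (\<lambda>h. F2 b h x)) (at x)" if "x \<in> V" for x b
  proof -
    have "F2 b h x = R powr k * (- k * (a x powr (- k - 1) * (2 * \<sigma> * (h \<bullet> b)) +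
        (- k - 1) * a x powr (- k - 1 - 1) * (2 * \<sigma> * ((x - c) \<bullet> h)) * (2 * \<sigma> * ((x - c) \<bullet> b))))" for h
    proof -
      have e: "- k - 1 - 1 = - k - 2" by simp
      show ?thesis unfolding F2_def e inner_commute[of b h] using \<sigma>2 by algebra
    qed
    moreover have "((\<lambda>x. 2 * \<sigma> * ((x - c) \<bullet> b)) has_derivative (\<lambda>h. 2 * \<sigma> * (h \<bullet> b))) (at x)"
      by (auto intro!: derivative_eq_intros)
    from has_derivative_mult_right[OF has_derivative_mult_right[OF
        has_derivative_mult[OF dp[OF that] this]], of "R powr k" "- k" "- k - 1"]
    have "(F1 b has_derivative (\<lambda>h. R powr k * (- k * (a x powr (- k - 1) * (2 * \<sigma> * (h \<bullet> b)) +
        (- k - 1) * a x powr (- k - 1 - 1) * (2 * \<sigma> * ((x - c) \<bullet> h)) * (2 * \<sigma> * ((x - c) \<bullet> b)))))) (at x)"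
      unfolding F1_def mult.assoc .
    ultimately show ?thesis by presburger
  qed
  have bs: "ball_solution \<sigma> c R x = F x" if "x \<in> V" for x
    using that \<open>R > 0\<close> unfolding ball_solution_def F_def V_def
    by (simp add: a_def[symmetric] k_def[symmetric] n_def[symmetric] powr_divide powr_minus_divide)
  have B0: "(ball_solution \<sigma> c R has_derivative (\<lambda>h. F1 h x)) (at x)" if "x \<in> V" for x
    using has_derivative_transform_within_open[OF F[OF that] \<open>open V\<close> that] bs by simp
  have B1: "(pderiv_at b (ball_solution \<sigma> c R) has_derivative (\<lambda>h. F2 b h x)) (at x)" if "x \<in> V" for x b
    using has_derivative_transform_within_open[OF F1[OF that, of b] \<open>open V\<close> that]
      pderiv_at_eqI[OF B0] by simp
  have B2: "pderiv_at b' (pderiv_at b (ball_solution \<sigma> c R)) x = F2 b b' x" if "x \<in> V" for x b b'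
    using pderiv_at_eqI[OF B1[OF that]] .
  have "continuous_on U (F2 b b')" for b b'
    unfolding F2_def a_def
    by (intro continuous_intros) (use UV in \<open>auto simp: V_def a_def\<close>)
  then have "continuous_on U (pderiv_at b' (pderiv_at b (ball_solution \<sigma> c R)))" for b b'
    by (rule continuous_on_cong[THEN iffD1, rotated -1]) (use B2 UV in auto)
  then have "Ck_on 2 (ball_solution \<sigma> c R) U"
    using differentiableI[OF B0] differentiableI[OF B1] UV by (auto simp: numeral_2_eq_2)
  moreover have pos: "ball_solution \<sigma> c R x > 0" if "x \<in> U" for x
    using bs[of x] UV that \<open>R > 0\<close> by (auto simp: F_def V_def)
  moreover have "laplacian (ball_solution \<sigma> c R) x =
      n * (n - 2) * ball_solution \<sigma> c R x powr ((n + 2) / (n - 2))" if "x \<in> U" for x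
  proof -
    have x: "x \<in> V" "a x > 0" using that UV by (auto simp: V_def)
    have e: "k * (n + 2) / (n - 2) = k + 2" using n by (simp add: k_def field_simps)
    have "F x powr ((n + 2) / (n - 2)) = R powr (k + 2) * a x powr (- k - 2)"
      using x \<open>R > 0\<close> unfolding F_def
      by (subst powr_mult) (auto simp: powr_powr e)
    also have "\<dots> = R powr k * R\<^sup>2 * a x powr (- k - 2)"
      using \<open>R > 0\<close> by (simp add: powr_add powr_numeral)
    finally have rhs: "F x powr ((n + 2) / (n - 2)) = R powr k * R\<^sup>2 * a x powr (- k - 2)" .
    have "- k - 2 + 1 = - k - 1" by simp
    from powr_add[of "a x" "- k - 2" 1, unfolded this]
    have a1: "a x powr (- k - 1) = a x powr (- k - 2) * a x" using x by simp
    have sq: "(\<Sum>b\<in>Basis. ((x - c) \<bullet> b) * ((x - c) \<bullet> b)) = (norm (x - c))\<^sup>2"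
      by (metis euclidean_inner power2_norm_eq_inner)
    \<comment> \<open>With \<open>k + 1 = n / 2\<close> the quadratic expression collapses:
        \<open>4 k (k + 1) |x - c|\<^sup>2 - 2 k n \<sigma> a = 2 k n (|x - c|\<^sup>2 - \<sigma> a) = 2 k n R\<^sup>2\<close>.\<close>
    have "laplacian (ball_solution \<sigma> c R) x = (\<Sum>b\<in>Basis. F2 b b x)"
      unfolding laplacian_def using B2[OF x(1)] by simp
    also have "\<dots> = (\<Sum>b\<in>(Basis::'a set). R powr k * (4 * k * (k + 1) * a x powr (- k - 2)) * (((x - c) \<bullet> b) * ((x - c) \<bullet> b))
      - R powr k * 2 * k * \<sigma> * a x powr (- k - 1))"
      by (intro sum.cong) (auto simp: F2_def algebra_simps)
    also have "\<dots> = R powr k * (4 * k * (k + 1) * a x powr (- k - 2)) * (norm (x - c))\<^sup>2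
      - n * (R powr k * 2 * k * \<sigma> * a x powr (- k - 1))"
      unfolding sum_subtractf sum_distrib_left[symmetric] sq by (simp add: n_def)
    also have "\<dots> = R powr k * a x powr (- k - 2) * (2 * k * n) * ((norm (x - c))\<^sup>2 - \<sigma> * a x)"
      unfolding a1 k(2) by (simp add: algebra_simps)
    also have "(norm (x - c))\<^sup>2 - \<sigma> * a x = R\<^sup>2" using \<sigma>2 unfolding a_def by algebra
    also have "2 * k * n = n * (n - 2)" by (simp add: k_def)
    finally show ?thesis unfolding bs[OF x(1)] rhs by (simp add: mult_ac)
  qed
  ultimately show ?thesis
    unfolding classical_solution_def Let_def n_def by simp
qed

text \<open>
  The nonlinearity is increasing, so that the comparison principle applies to any two
  solutions.
\<close>
lemma laplacian_less_of_less:
  fixes u :: "'a::euclidean_space \<Rightarrow> real"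
  assumes "DIM('a) \<ge> 3" "classical_solution U u" "classical_solution U z" "x \<in> U" "z x < u x"
  shows "laplacian z x < laplacian u x"
proof -
  define n where "n = real DIM('a)"
  have n: "n \<ge> 3" using assms(1) by (simp add: n_def)
  have "z x > 0" "laplacian z x = n * (n - 2) * z x powr ((n + 2) / (n - 2))"
    "laplacian u x = n * (n - 2) * u x powr ((n + 2) / (n - 2))"
    using assms(2,3,4) by (auto simp: classical_solution_def Let_def n_def)
  moreover have "z x powr ((n + 2) / (n - 2)) < u x powr ((n + 2) / (n - 2))"
    using n \<open>z x > 0\<close> assms(5) by (intro powr_less_mono2) auto
  ultimately show ?thesis using n by simp
qed

text \<open>
  A solution \<open>u\<close> is bounded on every slightly smaller concentric ball, where the explicit solution
  tends to infinity at the sphere. Comparison on the smaller ball and the limit \<open>R' \<rightarrow> R\<close> give the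
  claim.
\<close>
lemma classical_solution_le_ball_solution:
  fixes u :: "'a::euclidean_space \<Rightarrow> real"
  assumes dim: "DIM('a) \<ge> 3" and u: "classical_solution \<Omega> u" and sub: "ball c R \<subseteq> \<Omega>"
    and x: "x \<in> ball c R"
  shows "u x \<le> ball_solution (- 1) c R x"
proof -
  define k where "k = (real DIM('a) - 2) / 2"
  have k: "k > 0" using dim by (simp add: k_def)
  have x_less: "norm (x - c) < R" using x by (simp add: dist_norm norm_minus_commute)
  have smaller: "u x \<le> ball_solution (- 1) c R' x" if R': "norm (x - c) < R'" "R' < R" for R'
  proof -
    have "R' > 0" using R'(1) by (meson norm_ge_zero le_less_trans)
    have "cball c R' \<subseteq> \<Omega>" using R'(2) sub by auto
    have uR: "classical_solution (ball c R') u"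
      using u \<open>cball c R' \<subseteq> \<Omega>\<close> by (meson ball_subset_cball classical_solution_subset subset_trans)
    have zR: "classical_solution (ball c R') (ball_solution (- 1) c R')"
    proof (rule classical_solution_ball_solution[OF dim _ \<open>R' > 0\<close>])
      show "ball c R' \<subseteq> {x. - 1 * ((norm (x - c))\<^sup>2 - R'\<^sup>2) > 0}"
        using \<open>R' > 0\<close> by (auto simp: dist_norm norm_minus_commute intro: power_strict_mono)
    qed simp
    have "continuous_on (cball c R') u"
      using u \<open>cball c R' \<subseteq> \<Omega>\<close> unfolding classical_solution_def Let_def
      by (meson Ck_on_2_continuous continuous_on_subset)
    from compact_imp_bounded[OF compact_continuous_image[OF this compact_cball]]
    obtain M0 where "\<forall>y\<in>cball c R'. \<bar>u y\<bar> \<le> M0" by (auto simp: bounded_iff)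
    then have M0: "u y \<le> M0" if "y \<in> cball c R'" for y using that by fastforce
    define M where "M = max M0 1"
    \<comment> \<open>The level at which the solution on the smaller ball reaches \<open>M\<close>: it equals \<open>M\<close> where
        \<open>R'\<^sup>2 - |y - c|\<^sup>2 = \<epsilon>\<close> and is larger closer to the sphere.\<close>
    define \<epsilon> where "\<epsilon> = R' * M powr (- 1 / k)"
    have "M > 0" "\<epsilon> > 0" using \<open>R' > 0\<close> by (auto simp: M_def \<epsilon>_def)
    define K where "K = {y. (norm (y - c))\<^sup>2 \<le> R'\<^sup>2 - \<epsilon>}"
    have Ksub: "K \<subseteq> ball c R'"
    proof
      fix y assume "y \<in> K"
      then have "(norm (y - c))\<^sup>2 < R'\<^sup>2" using \<open>\<epsilon> > 0\<close> by (auto simp: K_def)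
      then have "norm (y - c) < R'" using \<open>R' > 0\<close> by (simp add: power2_less_imp_less)
      then show "y \<in> ball c R'" by (simp add: dist_norm norm_minus_commute)
    qed
    have "closed K" unfolding K_def by (intro closed_Collect_le continuous_intros)
    then have "compact K"
      using Ksub bounded_subset[OF bounded_ball] by (auto simp: compact_eq_bounded_closed)
    show ?thesis
    proof (rule comparison_principle[OF open_ball _ _ _ \<open>compact K\<close> Ksub])
      show "Ck_on 2 u (ball c R')" "Ck_on 2 (ball_solution (- 1) c R') (ball c R')"
        using uR zR by (simp_all add: classical_solution_def)
      show "laplacian (ball_solution (- 1) c R') y < laplacian u y"
        if "y \<in> ball c R'" "ball_solution (- 1) c R' y < u y" for y
        using laplacian_less_of_less[OF dim uR zR that] .
      show "x \<in> ball c R'" using R' by (simp add: dist_norm norm_minus_commute)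
      show "u y \<le> ball_solution (- 1) c R' y" if y: "y \<in> ball c R' - K" for y
      proof -
        define a where "a = R'\<^sup>2 - (norm (y - c))\<^sup>2"
        have "a > 0" using y by (auto simp: a_def dist_norm norm_minus_commute intro!: power_strict_mono)
        have "a < \<epsilon>" using y by (auto simp: a_def K_def)
        have "M = (R' / \<epsilon>) powr k"
          using \<open>R' > 0\<close> \<open>M > 0\<close> k by (simp add: \<epsilon>_def powr_minus_divide powr_powr)
        also have "\<dots> \<le> (R' / a) powr k"
          using \<open>R' > 0\<close> \<open>a > 0\<close> \<open>a < \<epsilon>\<close> k by (intro powr_mono2 divide_left_mono) auto
        also have "\<dots> = ball_solution (- 1) c R' y"
          by (simp add: ball_solution_def a_def k_def)
        finally show ?thesis using M0[of y] y by (auto simp: M_def)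
      qed
    qed
  qed
  have "R > 0" using x_less by (meson norm_ge_zero le_less_trans)
  have "(norm (x - c))\<^sup>2 < R\<^sup>2" using x_less by (simp add: power_strict_mono)
  then have "((\<lambda>R'. ball_solution (- 1) c R' x) \<longlongrightarrow> ball_solution (- 1) c R x) (at_left R)"
    unfolding ball_solution_def using \<open>R > 0\<close>
    by (intro tendsto_intros) auto
  moreover have "\<forall>\<^sub>F R' in at_left R. u x \<le> ball_solution (- 1) c R' x"
    using eventually_at_left_real[OF x_less] by (rule eventually_mono) (auto intro: smaller)
  ultimately show ?thesis
    by (rule tendsto_lowerbound) simp
qed

text \<open>
  The explicit solution outside the ball restricts to a solution on \<open>\<Omega>\<close>, so maximality applies to
  it directly.
\<close>
lemma ball_solution_le_maximal_solution:
  fixes u :: "'a::euclidean_space \<Rightarrow> real"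
  assumes dim: "DIM('a) \<ge> 3" and u: "maximal_solution \<Omega> u" and "open \<Omega>" "R > 0"
    and disj: "ball c R \<inter> \<Omega> = {}" and "x \<in> \<Omega>"
  shows "ball_solution 1 c R x \<le> u x"
proof -
  have "\<Omega> \<inter> cball c R = {}"
    using disj open_Int_closure_eq_empty[OF \<open>open \<Omega>\<close>, of "ball c R"] \<open>R > 0\<close> by auto
  then have "R < norm (y - c)" if "y \<in> \<Omega>" for y
    using that by (force simp: dist_norm norm_minus_commute)
  then have "\<Omega> \<subseteq> {x. 1 * ((norm (x - c))\<^sup>2 - R\<^sup>2) > 0}"
    using \<open>R > 0\<close> by (auto intro!: power_strict_mono)
  from classical_solution_ball_solution[OF dim _ \<open>R > 0\<close> this]
  show ?thesis using u \<open>x \<in> \<Omega>\<close> by (auto simp: maximal_solution_def)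
qed

section \<open>Interior gradient estimate\<close>

text \<open>
  Brandt's interior gradient estimate, by the maximum principle. The part \<open>(u - u \<circ> r) / 2\<close> of \<open>u\<close>
  that is odd under the reflection \<open>r\<close> in the hyperplane through \<open>x0\<close> orthogonal to \<open>e\<close> vanishes on
  this hyperplane. It is compared on a half ball with the barrier
  \<open>\<psi> = M |y - x0|\<^sup>2 / \<rho>\<^sup>2 + B t (\<rho> - t)\<close>, where \<open>t\<close> is the distance to the hyperplane: \<open>\<psi>\<close> is
  nonnegative on the flat part of the boundary and at least \<open>M\<close> on the spherical part. The barrier
  vanishes at \<open>x0\<close> with slope \<open>B \<rho>\<close>. The sign \<open>\<sigma>\<close> gives the bounds from above and from
  below at the same time.
\<close>
lemma directional_derivative_estimate:
  fixes u :: "'a::euclidean_space \<Rightarrow> real"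
  assumes u: "Ck_on 2 u U" and sub: "cball x0 \<rho> \<subseteq> U" and "\<rho> > 0" "M > 0"
    and M: "\<And>x. x \<in> cball x0 \<rho> \<Longrightarrow> \<bar>u x\<bar> \<le> M"
    and N: "\<And>x. x \<in> cball x0 \<rho> \<Longrightarrow> \<bar>laplacian u x\<bar> \<le> N"
    and e: "e \<in> Basis" and \<sigma>: "\<bar>\<sigma>\<bar> = 1"
  shows "\<sigma> * pderiv_at e u x0 \<le> (real DIM('a) + 1) * M / \<rho> + N * \<rho> / 2"
proof -
  define n where "n = real DIM('a)"
  \<comment> \<open>The choice of \<open>B\<close> makes \<open>\<Delta>\<psi> = 2 n M / \<rho>\<^sup>2 - 2 B\<close> strictly smaller than \<open>- N\<close>; this is
      why \<open>n + 1\<close> appears instead of \<open>n\<close>.\<close>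
  define B where "B = (n + 1) * M / \<rho>\<^sup>2 + N / 2"
  define t where "t y = (y - x0) \<bullet> e" for y
  define r where "r y = y - (2 * t y) *\<^sub>R e" for y
  define \<psi> where "\<psi> y = M * (norm (y - x0))\<^sup>2 / \<rho>\<^sup>2 + B * t y * (\<rho> - t y)" for y
  define F where "F y = \<sigma> * (u y - u (r y)) / 2 - \<psi> y" for y
  define K where "K = cball x0 \<rho> \<inter> {y. 0 \<le> t y}"
  have "N \<ge> 0" using N[of x0] \<open>\<rho> > 0\<close> by force
  then have "B > 0" using \<open>M > 0\<close> \<open>\<rho> > 0\<close> by (simp add: B_def n_def add_pos_nonneg)
  have ee: "e \<bullet> e = 1" "norm e = 1" using e by auto
  have r_norm: "norm (r y - x0) = norm (y - x0)" for y
  proof -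
    have "(norm (z - (2 * (z \<bullet> e)) *\<^sub>R e))\<^sup>2 = (norm z)\<^sup>2" for z
      unfolding power2_norm_eq_inner
      by (simp add: inner_diff_left inner_diff_right inner_commute ee)
    from this[of "y - x0"] show ?thesis by (simp add: r_def t_def algebra_simps)
  qed
  have r_cball: "r y \<in> cball x0 \<rho>" if "y \<in> cball x0 \<rho>" for y
    using that r_norm[of y] by (simp add: dist_norm norm_minus_commute)
  have odd: "\<bar>\<sigma> * (u y - u (r y)) / 2\<bar> \<le> M" if "y \<in> cball x0 \<rho>" for y
    using M[OF that] M[OF r_cball[OF that]] \<sigma> by (simp add: abs_mult)
  have oddN: "\<bar>\<sigma> * (laplacian u y - laplacian u (r y)) / 2\<bar> \<le> N" if "y \<in> cball x0 \<rho>" for y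
    using N[OF that] N[OF r_cball[OF that]] \<sigma> by (simp add: abs_mult)
  have t_le: "t y \<le> \<rho>" if "y \<in> cball x0 \<rho>" for y
    using Cauchy_Schwarz_ineq2[of "y - x0" e] that ee
    by (simp add: t_def dist_norm norm_minus_commute)
  have F_nonpos: "F y \<le> 0" if "y \<in> K" for y
  proof (rule ccontr)
    assume "\<not> F y \<le> 0"
    have "continuous_on (cball x0 \<rho>) u"
      using Ck_on_2_continuous[OF u] sub by (rule continuous_on_subset)
    moreover have "continuous_on (cball x0 \<rho>) r"
      unfolding r_def t_def by (intro continuous_intros)
    moreover have "continuous_on (cball x0 \<rho>) \<psi>"
      unfolding \<psi>_def t_def by (intro continuous_intros) (use \<open>\<rho> > 0\<close> in auto)
    ultimately have "continuous_on (cball x0 \<rho>) F"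
      unfolding F_def using r_cball
      by (intro continuous_intros continuous_on_compose2[of "cball x0 \<rho>" u _ r]) auto
    then have "continuous_on K F" by (rule continuous_on_subset) (auto simp: K_def)
    moreover have "compact K"
      unfolding K_def t_def by (intro compact_Int_closed closed_Collect_le continuous_intros) auto
    ultimately obtain z where z: "z \<in> K" "\<And>y. y \<in> K \<Longrightarrow> F y \<le> F z"
      using continuous_attains_sup[of K F] \<open>y \<in> K\<close> by blast
    have pos: "F z > 0" using z(2)[OF \<open>y \<in> K\<close>] \<open>\<not> F y \<le> 0\<close> by linarith
    have zc: "z \<in> cball x0 \<rho>" "0 \<le> t z" using z by (auto simp: K_def)
    have "t z \<noteq> 0"
    proof
      assume "t z = 0"
      then have "F z = - (M * (norm (z - x0))\<^sup>2 / \<rho>\<^sup>2)" by (simp add: F_def r_def \<psi>_def)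
      also have "\<dots> \<le> 0" using \<open>M > 0\<close> by simp
      finally show False using pos by simp
    qed
    then have tz: "t z > 0" using zc by simp
    have "dist x0 z \<noteq> \<rho>"
    proof
      assume "dist x0 z = \<rho>"
      then have "\<psi> z = M + B * t z * (\<rho> - t z)"
        using \<open>\<rho> > 0\<close> by (simp add: \<psi>_def dist_norm norm_minus_commute)
      moreover have "B * t z * (\<rho> - t z) \<ge> 0"
        using \<open>B > 0\<close> tz t_le[OF zc(1)] by simp
      ultimately show False using odd[OF zc(1)] pos by (simp add: F_def)
    qed
    then have "z \<in> ball x0 \<rho> \<inter> {y. 0 < t y}" using zc tz by auto
    moreover have "open (ball x0 \<rho> \<inter> {y. 0 < t y})"
      unfolding t_def by (intro open_Int open_Collect_less continuous_intros open_ball)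
    ultimately obtain \<epsilon> where \<epsilon>: "\<epsilon> > 0" "ball z \<epsilon> \<subseteq> ball x0 \<rho> \<inter> {y. 0 < t y}"
      using openE by blast
    \<comment> \<open>\<open>D b\<close> is the second derivative of \<open>F\<close> in direction \<open>b\<close>. It is computed along the line
        through \<open>z\<close>, whose mirror image runs through \<open>r z\<close> in direction \<open>b\<close> or \<open>- b\<close>.\<close>
    define D where "D b = \<sigma> * (pderiv_at b (pderiv_at b u) z - pderiv_at b (pderiv_at b u) (r z)) / 2
        - (2 * M / \<rho>\<^sup>2 - 2 * B * (b \<bullet> e))" for b
    have "D b \<le> 0" if b: "b \<in> Basis" for b
    proof -
      define \<tau> where "\<tau> = (if b = e then - 1 else 1 :: real)"
      define \<beta> where "\<beta> = (z - x0) \<bullet> b"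
      have \<tau>: "\<tau> * \<tau> = 1" by (simp add: \<tau>_def)
      have be: "(b \<bullet> e) * (b \<bullet> e) = b \<bullet> e" using b e by (simp add: inner_Basis)
      have inK: "z + s *\<^sub>R b \<in> cball x0 \<rho>" "z + s *\<^sub>R b \<in> K" if "\<bar>s\<bar> < \<epsilon>" for s
      proof -
        have "z + s *\<^sub>R b \<in> ball z \<epsilon>" using that b by (simp add: dist_norm)
        then have "z + s *\<^sub>R b \<in> ball x0 \<rho> \<inter> {y. 0 < t y}" using \<epsilon>(2) by blast
        then show "z + s *\<^sub>R b \<in> cball x0 \<rho>" "z + s *\<^sub>R b \<in> K" by (auto simp: K_def)
      qed
      have r_line: "r (z + s *\<^sub>R b) = r z + (\<tau> * s) *\<^sub>R b" for s
      proof -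
        have t_line: "2 * t (z + s *\<^sub>R b) = 2 * t z + 2 * (s * (b \<bullet> e))"
          by (simp add: t_def inner_diff_left inner_add_left)
        have sb: "s *\<^sub>R b - (2 * (s * (b \<bullet> e))) *\<^sub>R e = (\<tau> * s) *\<^sub>R b"
          using b e by (cases "b = e")
            (simp_all add: \<tau>_def inner_Basis flip: scaleR_left_diff_distrib)
        show ?thesis by (simp only: r_def t_line scaleR_left_distrib add_diff_add sb)
      qed
      have \<psi>_line: "\<psi> (z + s *\<^sub>R b) = M * ((norm (z - x0))\<^sup>2 + 2 * s * \<beta> + s\<^sup>2) / \<rho>\<^sup>2
          + B * (t z + s * (b \<bullet> e)) * (\<rho> - (t z + s * (b \<bullet> e)))" for s
      proof -
        have "(norm (z + s *\<^sub>R b - x0))\<^sup>2 = (norm (z - x0))\<^sup>2 + 2 * s * \<beta> + s\<^sup>2"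
          unfolding power2_norm_eq_inner \<beta>_def using b
          by (simp add: inner_commute algebra_simps power2_eq_square)
        then show ?thesis by (simp add: \<psi>_def t_def algebra_simps)
      qed
      have uz: "((\<lambda>s. u (z + s *\<^sub>R b)) has_real_derivative pderiv_at b u (z + s *\<^sub>R b)) (at s)"
        if "\<bar>s\<bar> < \<epsilon>" for s
        using inK[OF that] sub by (intro has_derivative_along_line Ck_on_2D(1)[OF u]) auto
      have ur: "((\<lambda>s. u (r z + (\<tau> * s) *\<^sub>R b)) has_real_derivative
          pderiv_at b u (r z + (\<tau> * s) *\<^sub>R b) * \<tau>) (at s)" if "\<bar>s\<bar> < \<epsilon>" for s
      proof (rule DERIV_chain2[of "\<lambda>s. u (r z + s *\<^sub>R b)"])
        show "((\<lambda>s. u (r z + s *\<^sub>R b)) has_real_derivative pderiv_at b u (r z + (\<tau> * s) *\<^sub>R b)) (at (\<tau> * s))"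
          using r_cball[OF inK(1)[OF that]] sub
          by (intro has_derivative_along_line Ck_on_2D(1)[OF u]) (auto simp: r_line)
      qed (auto intro!: derivative_eq_intros)
      have uz2: "((\<lambda>s. pderiv_at b u (z + s *\<^sub>R b)) has_real_derivative
          pderiv_at b (pderiv_at b u) z) (at 0)"
        using has_derivative_along_line[of "pderiv_at b u" z 0 b] Ck_on_2D(2)[OF u _ b] zc sub
        by auto
      have ur2: "((\<lambda>s. pderiv_at b u (r z + (\<tau> * s) *\<^sub>R b)) has_real_derivative
          pderiv_at b (pderiv_at b u) (r z) * \<tau>) (at 0)"
      proof (rule DERIV_chain2[of "\<lambda>s. pderiv_at b u (r z + s *\<^sub>R b)"])
        show "((\<lambda>s. pderiv_at b u (r z + s *\<^sub>R b)) has_real_derivative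
            pderiv_at b (pderiv_at b u) (r z)) (at (\<tau> * 0))"
          using has_derivative_along_line[of "pderiv_at b u" "r z" 0 b]
            Ck_on_2D(2)[OF u _ b] r_cball[OF zc(1)] sub by auto
      qed (auto intro!: derivative_eq_intros)
      define p' where "p' s = M * (2 * \<beta> + 2 * s) / \<rho>\<^sup>2 + B * (b \<bullet> e) * (\<rho> - 2 * (t z + s * (b \<bullet> e)))" for s
      have p: "((\<lambda>s. M * ((norm (z - x0))\<^sup>2 + 2 * s * \<beta> + s\<^sup>2) / \<rho>\<^sup>2
          + B * (t z + s * (b \<bullet> e)) * (\<rho> - (t z + s * (b \<bullet> e)))) has_real_derivative p' s) (at s)" for s
        unfolding p'_def
        by (rule DERIV_add DERIV_cdivide DERIV_cmult derivative_eq_intros refl)+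
          (simp add: algebra_simps)
      have p2: "(p' has_real_derivative 2 * M / \<rho>\<^sup>2 - 2 * B * (b \<bullet> e)) (at 0)"
      proof -
        have "(p' has_real_derivative M * 2 / \<rho>\<^sup>2 + B * (b \<bullet> e) * - (2 * (b \<bullet> e))) (at 0)"
          unfolding p'_def
          by (rule DERIV_add DERIV_cdivide DERIV_cmult)+ (auto intro!: derivative_eq_intros)
        also have "M * 2 / \<rho>\<^sup>2 + B * (b \<bullet> e) * - (2 * (b \<bullet> e)) = 2 * M / \<rho>\<^sup>2 - 2 * B * ((b \<bullet> e) * (b \<bullet> e))"
          by simp
        finally show ?thesis unfolding be .
      qed
      define h' where "h' s = \<sigma> * (pderiv_at b u (z + s *\<^sub>R b) - pderiv_at b u (r z + (\<tau> * s) *\<^sub>R b) * \<tau>) / 2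
          - p' s" for s
      show ?thesis
      proof (rule second_derivative_nonpos_at_max[OF \<epsilon>(1)])
        show "((\<lambda>s. F (z + s *\<^sub>R b)) has_real_derivative h' s) (at s)" if "\<bar>s\<bar> < \<epsilon>" for s
          unfolding F_def \<psi>_line r_line h'_def
          by (intro DERIV_diff DERIV_cdivide DERIV_cmult p uz[OF that] ur[OF that])
        show "(h' has_real_derivative D b) (at 0)"
        proof -
          have "(h' has_real_derivative \<sigma> * (pderiv_at b (pderiv_at b u) z -
              pderiv_at b (pderiv_at b u) (r z) * \<tau> * \<tau>) / 2 - (2 * M / \<rho>\<^sup>2 - 2 * B * (b \<bullet> e))) (at 0)"
            unfolding h'_def
            by (intro DERIV_diff DERIV_cdivide DERIV_cmult DERIV_cmult_right p2 uz2 ur2)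
          then show ?thesis unfolding D_def mult.assoc[of _ \<tau> \<tau>] \<tau> by simp
        qed
        show "F (z + s *\<^sub>R b) \<le> F (z + 0 *\<^sub>R b)" if "\<bar>s\<bar> < \<epsilon>" for s
          using z(2)[OF inK(2)[OF that]] by simp
      qed
    qed
    then have "(\<Sum>b\<in>Basis. D b) \<le> 0" by (intro sum_nonpos) auto
    moreover have "(\<Sum>b\<in>Basis. D b) = \<sigma> * (laplacian u z - laplacian u (r z)) / 2
        - (n * (2 * M / \<rho>\<^sup>2) - 2 * B)"
    proof -
      have "(\<Sum>b\<in>Basis. b \<bullet> e) = (1::real)"
        using e by (simp add: inner_Basis sum.delta)
      then show ?thesis
        unfolding D_def laplacian_def sum_subtractf[symmetric]
        by (simp add: sum_subtractf sum_divide_distrib[symmetric] sum_distrib_left[symmetric] n_def)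
    qed
    moreover have "2 * B - n * (2 * M / \<rho>\<^sup>2) = 2 * M / \<rho>\<^sup>2 + N"
      unfolding B_def using \<open>\<rho> > 0\<close> by (simp add: field_simps)
    moreover have "2 * M / \<rho>\<^sup>2 > 0" using \<open>M > 0\<close> \<open>\<rho> > 0\<close> by simp
    moreover define S A where "S = \<sigma> * (laplacian u z - laplacian u (r z)) / 2" and "A = 2 * M / \<rho>\<^sup>2"
    moreover have "- N \<le> S" using oddN[OF zc(1)] unfolding S_def[symmetric] by linarith
    ultimately show False unfolding S_def[symmetric] A_def[symmetric] by linarith
  qed
  have inU: "x0 \<in> U" using sub \<open>\<rho> > 0\<close> by (meson centre_in_cball less_imp_le subsetD)
  \<comment> \<open>\<open>F \<le> 0\<close> on the segment that starts at \<open>x0\<close> in direction \<open>e\<close>, with equality at \<open>x0\<close>, bounds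
      the slope of \<open>F\<close> there.\<close>
  define g where "g s = \<sigma> * (u (x0 + s *\<^sub>R e) - u (x0 + (- 1 * s) *\<^sub>R e)) / 2 - (M * s\<^sup>2 / \<rho>\<^sup>2 + B * s * (\<rho> - s))" for s
  have line: "((\<lambda>s. u (x0 + s *\<^sub>R e)) has_real_derivative pderiv_at e u x0) (at 0)"
    using has_derivative_along_line[of u x0 0 e] Ck_on_2D(1)[OF u inU] by simp
  have line': "((\<lambda>s. u (x0 + (- 1 * s) *\<^sub>R e)) has_real_derivative pderiv_at e u x0 * - 1) (at 0)"
    by (rule DERIV_chain2[of "\<lambda>s. u (x0 + s *\<^sub>R e)"])
      (use line in \<open>auto intro!: derivative_eq_intros\<close>)
  have g': "(g has_real_derivative \<sigma> * pderiv_at e u x0 - B * \<rho>) (at 0)"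
  proof -
    have "((\<lambda>s. M * s\<^sup>2 / \<rho>\<^sup>2 + B * s * (\<rho> - s)) has_real_derivative M * (2 * 0) / \<rho>\<^sup>2 + B * \<rho>) (at 0)"
      by (rule DERIV_add DERIV_cdivide DERIV_cmult)+ (auto intro!: derivative_eq_intros)
    then have "(g has_real_derivative \<sigma> * (pderiv_at e u x0 - pderiv_at e u x0 * - 1) / 2
        - (M * (2 * 0) / \<rho>\<^sup>2 + B * \<rho>)) (at 0)"
      unfolding g_def by (intro DERIV_diff DERIV_cdivide DERIV_cmult line line')
    then show ?thesis by simp
  qed
  have g_nonpos: "g s \<le> 0" if "0 < s" "s \<le> \<rho>" for s
  proof -
    have "t (x0 + s *\<^sub>R e) = s" using ee by (simp add: t_def)
    moreover have "r (x0 + s *\<^sub>R e) = x0 + (- 1 * s) *\<^sub>R e"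
      unfolding r_def calculation add_diff_eq[symmetric]
      by (simp flip: scaleR_left_diff_distrib)
    ultimately have "g s = F (x0 + s *\<^sub>R e)" and "x0 + s *\<^sub>R e \<in> K"
      using that ee by (auto simp: g_def F_def \<psi>_def K_def dist_norm)
    then show ?thesis using F_nonpos by simp
  qed
  have "\<sigma> * pderiv_at e u x0 - B * \<rho> \<le> 0"
  proof (rule ccontr)
    assume "\<not> ?thesis"
    then obtain d where d: "d > 0" "\<And>h. h > 0 \<Longrightarrow> h < d \<Longrightarrow> g 0 < g (0 + h)"
      using has_real_derivative_pos_inc_right[OF g'] by auto
    define h where "h = min d \<rho> / 2"
    have "0 < h" "h < d" "h \<le> \<rho>" using d(1) \<open>\<rho> > 0\<close> by (auto simp: h_def)
    then show False using d(2)[of h] g_nonpos[of h] by (simp add: g_def)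
  qed
  moreover have "B * \<rho> = (n + 1) * M / \<rho> + N * \<rho> / 2"
    using \<open>\<rho> > 0\<close> by (simp add: B_def field_simps power2_eq_square)
  ultimately show ?thesis by (simp add: n_def)
qed

text \<open>
  If \<open>v = u powr (- 2 / (n - 2))\<close> is at least \<open>\<rho>\<close> on a ball of radius \<open>\<rho>\<close> and at most \<open>6 \<rho>\<close> at its
  centre, the partial derivatives of \<open>v\<close> at the centre are bounded independently of \<open>\<rho>\<close>. The
  equation for \<open>u\<close> is invariant under the scaling that normalises \<open>\<rho>\<close> to 1.
\<close>
lemma solution_pderiv_bound:
  fixes u :: "'a::euclidean_space \<Rightarrow> real"
  assumes dim: "DIM('a) \<ge> 3" and u: "classical_solution U u" and sub: "cball x \<rho> \<subseteq> U" and "\<rho> > 0"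
    and lower: "\<And>y. y \<in> cball x \<rho> \<Longrightarrow> \<rho> \<le> u y powr (- 2 / (real DIM('a) - 2))"
    and upper: "u x powr (- 2 / (real DIM('a) - 2)) \<le> 6 * \<rho>"
    and b: "b \<in> Basis" and n: "n = real DIM('a)"
  shows "\<bar>- 2 / (n - 2) * u x powr (- 2 / (n - 2) - 1) * pderiv_at b u x\<bar>
    \<le> 2 / (n - 2) * 6 powr (n / 2) * (n + 1 + n * (n - 2) / 2)"
proof -
  have n3: "n \<ge> 3" using dim by (simp add: n)
  define k where "k = (n - 2) / 2"
  have k: "k > 0" "k + 1 = n / 2" "- 2 / (n - 2) = - 1 / k" "k * ((n + 2) / (n - 2)) = k + 2"
    using n3 by (auto simp: k_def field_simps)
  note lower' = lower[folded n, unfolded k(3)] and upper' = upper[folded n, unfolded k(3)]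
  have upos: "u y > 0" if "y \<in> U" for y using u that by (simp add: classical_solution_def)
  \<comment> \<open>\<open>M\<close> and \<open>N\<close> bound \<open>u\<close> and its Laplacian on the ball; both \<open>M / \<rho>\<close> and \<open>N \<rho>\<close> scale like
      \<open>\<rho> powr (- k - 1)\<close>, which the factor \<open>u powr (- 1 / k - 1)\<close>, at most of order \<open>\<rho> powr (k + 1)\<close>, cancels.\<close>
  define M where "M = \<rho> powr (- k)"
  define N where "N = n * (n - 2) * \<rho> powr (- k - 2)"
  have u_eq: "u y = (u y powr (- 1 / k)) powr (- k)" if "y \<in> U" for y
    using upos[OF that] k(1) by (simp add: powr_powr)
  have uM: "u y \<le> M" if "y \<in> cball x \<rho>" for y
  proof -
    have "u y = (u y powr (- 1 / k)) powr (- k)" using u_eq that sub by blast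
    also have "\<dots> \<le> \<rho> powr (- k)"
      using lower'[OF that] k(1) \<open>\<rho> > 0\<close> by (intro powr_mono2') auto
    finally show ?thesis by (simp add: M_def)
  qed
  have x: "x \<in> cball x \<rho>" "x \<in> U" using sub \<open>\<rho> > 0\<close> by auto
  have est: "\<sigma> * pderiv_at b u x \<le> (n + 1) * M / \<rho> + N * \<rho> / 2" if "\<bar>\<sigma>\<bar> = 1" for \<sigma>
    unfolding n
  proof (rule directional_derivative_estimate[OF _ sub \<open>\<rho> > 0\<close> _ _ _ b that])
    show "Ck_on 2 u U" using u by (simp add: classical_solution_def)
    show "M > 0" using \<open>\<rho> > 0\<close> by (simp add: M_def)
    show "\<bar>u y\<bar> \<le> M" if "y \<in> cball x \<rho>" for y
      using uM[OF that] upos[of y] that sub by (simp add: subset_iff abs_of_pos)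
    show "\<bar>laplacian u y\<bar> \<le> N" if "y \<in> cball x \<rho>" for y
    proof -
      have y: "y \<in> U" using that sub by auto
      have "laplacian u y = n * (n - 2) * u y powr ((n + 2) / (n - 2))"
        using u y by (simp add: classical_solution_def Let_def n)
      moreover have "u y powr ((n + 2) / (n - 2)) \<le> M powr ((n + 2) / (n - 2))"
        using uM[OF that] upos[OF y] n3 by (intro powr_mono2) auto
      moreover have "M powr ((n + 2) / (n - 2)) = \<rho> powr (- k - 2)"
      proof -
        have "- k * ((n + 2) / (n - 2)) = - k - 2" using k(4) by linarith
        then show ?thesis unfolding M_def powr_powr by (simp only:)
      qed
      ultimately show ?thesis
        using n3 by (simp add: N_def abs_mult)
    qed
  qed
  define C where "C = n + 1 + n * (n - 2) / 2"
  have "C \<ge> 0" using n3 by (simp add: C_def)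
  have "(n + 1) * M / \<rho> + N * \<rho> / 2 = C * \<rho> powr (- k - 1)"
  proof -
    have e: "- k - 1 + 1 = - k" "- k - 2 + 1 = - k - 1" by auto
    have "M = \<rho> powr (- k - 1) * \<rho>" "\<rho> powr (- k - 1) = \<rho> powr (- k - 2) * \<rho>"
      using powr_add[of \<rho> "- k - 1" 1] powr_add[of \<rho> "- k - 2" 1] \<open>\<rho> > 0\<close>
      unfolding e M_def by auto
    then have "(n + 1) * M / \<rho> = (n + 1) * \<rho> powr (- k - 1)"
      and "N * \<rho> / 2 = n * (n - 2) / 2 * \<rho> powr (- k - 1)"
      using \<open>\<rho> > 0\<close> by (simp_all add: N_def)
    then show ?thesis by (simp add: C_def distrib_right)
  qed
  then have pd: "\<bar>pderiv_at b u x\<bar> \<le> C * \<rho> powr (- k - 1)"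
    using est[of 1] est[of "- 1"] by (simp add: abs_le_iff)
  have "u x powr (- 1 / k - 1) = (u x powr (- 1 / k)) powr (k + 1)"
  proof -
    have "- 1 / k - 1 = - 1 / k * (k + 1)" using k(1) by (simp add: field_simps)
    then show ?thesis by (simp only: powr_powr)
  qed
  also have "\<dots> \<le> (6 * \<rho>) powr (k + 1)"
    using upper' k(1) by (intro powr_mono2) auto
  also have "\<dots> = 6 powr (k + 1) * \<rho> powr (k + 1)" using \<open>\<rho> > 0\<close> by (simp add: powr_mult)
  finally have up: "u x powr (- 1 / k - 1) \<le> 6 powr (k + 1) * \<rho> powr (k + 1)" .
  have "u x powr (- 1 / k - 1) * \<bar>pderiv_at b u x\<bar>
      \<le> (6 powr (k + 1) * \<rho> powr (k + 1)) * (C * \<rho> powr (- k - 1))"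
    using up pd by (intro mult_mono) auto
  also have "\<dots> = 6 powr (k + 1) * C * (\<rho> powr (k + 1) * \<rho> powr (- k - 1))" by (simp add: mult_ac)
  also have "\<rho> powr (k + 1) * \<rho> powr (- k - 1) = 1"
    using \<open>\<rho> > 0\<close> by (simp flip: powr_add)
  finally have "1 / k * (u x powr (- 1 / k - 1) * \<bar>pderiv_at b u x\<bar>) \<le> 1 / k * (6 powr (k + 1) * C * 1)"
    using k(1) by (intro mult_left_mono) auto
  then have "\<bar>- 1 / k * u x powr (- 1 / k - 1) * pderiv_at b u x\<bar> \<le> 1 / k * 6 powr (n / 2) * C"
    using k(1) by (simp add: abs_mult k(2))
  moreover have "1 / k = 2 / (n - 2)" by (simp add: k_def)
  ultimately show ?thesis unfolding k(3) C_def by simp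
qed

section \<open>Touching balls on both sides of the boundary\<close>

lemma uniform_bound_finite:
  fixes f :: "'i \<Rightarrow> 'b \<Rightarrow> real"
  assumes "finite A" "\<And>a. a \<in> A \<Longrightarrow> \<exists>K. \<forall>x\<in>S. f a x \<le> K"
  shows "\<exists>K\<ge>0. \<forall>a\<in>A. \<forall>x\<in>S. f a x \<le> K"
proof -
  from assms(2) have "\<forall>a\<in>A. \<exists>K. \<forall>x\<in>S. f a x \<le> K" by blast
  from bchoice[OF this] obtain K where K: "\<forall>a\<in>A. \<forall>x\<in>S. f a x \<le> K a" by blast
  have "K a \<le> (\<Sum>a\<in>A. \<bar>K a\<bar>)" if "a \<in> A" for a
    using member_le_sum[of a A "\<lambda>a. \<bar>K a\<bar>"] that \<open>finite A\<close> by force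
  then have "\<forall>a\<in>A. \<forall>x\<in>S. f a x \<le> (\<Sum>a\<in>A. \<bar>K a\<bar>)" 
    using K order_trans by blast
  moreover have "(\<Sum>a\<in>A. \<bar>K a\<bar>) \<ge> 0" by (simp add: sum_nonneg)
  ultimately show ?thesis by blast
qed

lemma Ck_Holder_on_0_ball_bounded:
  assumes "Ck_Holder_on 0 \<alpha> f (ball p r)" "0 \<le> \<alpha>" "r > 0"
  shows "\<exists>K. \<forall>x\<in>ball p r. \<bar>f x\<bar> \<le> K"
proof -
  obtain C where C: "\<And>x y. x \<in> ball p r \<Longrightarrow> y \<in> ball p r \<Longrightarrow> \<bar>f x - f y\<bar> \<le> C * dist x y powr \<alpha>"
    using assms(1) unfolding Ck_Holder_on.simps by blast
  have "\<bar>f x\<bar> \<le> \<bar>f p\<bar> + \<bar>C\<bar> * r powr \<alpha>" if x: "x \<in> ball p r" for x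
  proof -
    have "\<bar>f x - f p\<bar> \<le> C * dist x p powr \<alpha>" using C[OF x] \<open>r > 0\<close> by simp
    also have "\<dots> \<le> \<bar>C\<bar> * r powr \<alpha>"
      using x \<open>0 \<le> \<alpha>\<close> by (intro mult_mono powr_mono2) (auto simp: dist_commute)
    finally show ?thesis by linarith
  qed
  then show ?thesis by blast
qed

lemma pderiv_at_MVT:
  fixes f :: "'a::euclidean_space \<Rightarrow> real"
  assumes "\<And>y. y \<in> U \<Longrightarrow> f differentiable (at y)" "convex U" "x \<in> U" "x + z \<in> U"
    and "0 < t" "t \<le> 1"
  obtains s where "0 < s" "s < t" "f (x + t *\<^sub>R z) - f x = t * pderiv_at z f (x + s *\<^sub>R z)"
proof -
  have inU: "x + s *\<^sub>R z \<in> U" if "0 \<le> s" "s \<le> t" for s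
  proof -
    have "(1 - s) *\<^sub>R x + s *\<^sub>R (x + z) \<in> U"
      using assms that by (intro convexD) auto
    then show ?thesis by (simp add: algebra_simps)
  qed
  have "\<exists>s>0. s < t \<and> f (x + t *\<^sub>R z) - f (x + 0 *\<^sub>R z) = (t - 0) * pderiv_at z f (x + s *\<^sub>R z)"
    using MVT2[OF \<open>0 < t\<close>, of "\<lambda>s. f (x + s *\<^sub>R z)" "\<lambda>s. pderiv_at z f (x + s *\<^sub>R z)"]
      has_derivative_along_line[OF assms(1)[OF inU]] by blast
  then show ?thesis using that by auto
qed

text \<open>
  Second derivatives that are Hoelder continuous on a ball are bounded there; the mean value theorem,
  applied to \<open>f\<close> and then to its partial derivatives, gives a first-order Taylor formula with
  quadratic remainder, uniformly in both points.
\<close>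
lemma quadratic_remainder_bound:
  fixes f :: "'a::euclidean_space \<Rightarrow> real"
  assumes f: "Ck_Holder_on 2 \<alpha> f (ball p r)" and "0 \<le> \<alpha>" "r > 0"
  shows "\<exists>L\<ge>0. \<forall>x\<in>ball p r. \<forall>y\<in>ball p r. \<bar>f y - f x - gradient f x \<bullet> (y - x)\<bar> \<le> L * (norm (y - x))\<^sup>2"
proof -
  have d1: "f differentiable (at x)" and d2: "b \<in> Basis \<Longrightarrow> pderiv_at b f differentiable (at x)"
    if "x \<in> ball p r" for x b
    using f that by (auto simp: numeral_2_eq_2)
  have "\<exists>K. \<forall>z\<in>Basis \<times> ball p r. \<bar>pderiv_at (fst z) (pderiv_at b f) (snd z)\<bar> \<le> K" if b: "b \<in> Basis" for b
  proof -
    have "\<exists>K. \<forall>x\<in>ball p r. \<bar>pderiv_at b' (pderiv_at b f) x\<bar> \<le> K" if "b' \<in> Basis" for b'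
    proof (rule Ck_Holder_on_0_ball_bounded[OF _ assms(2,3)])
      show "Ck_Holder_on 0 \<alpha> (pderiv_at b' (pderiv_at b f)) (ball p r)"
        using f b that unfolding numeral_2_eq_2 Ck_Holder_on.simps(2) by blast
    qed
    from uniform_bound_finite[where f = "\<lambda>b' x. \<bar>pderiv_at b' (pderiv_at b f) x\<bar>", OF finite_Basis this]
    obtain K where "\<forall>b'\<in>Basis. \<forall>x\<in>ball p r. \<bar>pderiv_at b' (pderiv_at b f) x\<bar> \<le> K" by blast
    then show ?thesis by (intro exI[of _ K]) simp
  qed
  from uniform_bound_finite[of Basis _ "\<lambda>b z. \<bar>pderiv_at (fst z) (pderiv_at b f) (snd z)\<bar>", OF finite_Basis this]
  obtain K where "K \<ge> 0" and K': "\<forall>b\<in>Basis. \<forall>z\<in>Basis \<times> ball p r. \<bar>pderiv_at (fst z) (pderiv_at b f) (snd z)\<bar> \<le> K"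
    by blast
  have K: "\<bar>pderiv_at b' (pderiv_at b f) x\<bar> \<le> K" if "b \<in> Basis" "b' \<in> Basis" "x \<in> ball p r" for b b' x
  proof -
    have "(b', x) \<in> Basis \<times> ball p r" using that by simp
    then have "\<bar>pderiv_at (fst (b', x)) (pderiv_at b f) (snd (b', x))\<bar> \<le> K" using K' that(1) by blast
    then show ?thesis by simp
  qed
  define n where "n = real DIM('a)"
  have sum_bound: "\<bar>\<Sum>b\<in>Basis. a b * (z \<bullet> b)\<bar> \<le> n * (A * norm z)"
    if "\<And>b. b \<in> Basis \<Longrightarrow> \<bar>a b\<bar> \<le> A" for a A and z :: 'a
  proof -
    have "\<bar>\<Sum>b\<in>Basis. a b * (z \<bullet> b)\<bar> \<le> (\<Sum>b\<in>(Basis::'a set). \<bar>a b * (z \<bullet> b)\<bar>)" by (rule sum_abs)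
    also have "\<dots> \<le> (\<Sum>b\<in>(Basis::'a set). A * norm z)"
      unfolding abs_mult using that Basis_le_norm
      by (intro sum_mono mult_mono) (auto intro: order_trans[OF abs_ge_zero that])
    finally show ?thesis by (simp add: n_def)
  qed
  have "\<bar>f y - f x - gradient f x \<bullet> (y - x)\<bar> \<le> n * (n * K) * (norm (y - x))\<^sup>2"
    if x: "x \<in> ball p r" and y: "y \<in> ball p r" for x y
  proof -
    define z where "z = y - x"
    have xz: "x + z \<in> ball p r" using y by (simp add: z_def)
    obtain s where s: "0 < s" "s < 1" "f y - f x = pderiv_at z f (x + s *\<^sub>R z)"
      using pderiv_at_MVT[OF d1 convex_ball x xz, of 1] by (auto simp: z_def)
    have inB: "x + t *\<^sub>R z \<in> ball p r" if "0 \<le> t" "t \<le> 1" for t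
    proof -
      have "(1 - t) *\<^sub>R x + t *\<^sub>R (x + z) \<in> ball p r"
        using x xz that by (intro convexD[OF convex_ball]) auto
      then show ?thesis by (simp add: algebra_simps)
    qed
    have diff: "\<bar>pderiv_at b f (x + s *\<^sub>R z) - pderiv_at b f x\<bar> \<le> n * (K * norm z)" if b: "b \<in> Basis" for b
    proof -
      obtain t where t: "0 < t" "t < s"
        "pderiv_at b f (x + s *\<^sub>R z) - pderiv_at b f x = s * pderiv_at z (pderiv_at b f) (x + t *\<^sub>R z)"
        using pderiv_at_MVT[of "ball p r" "pderiv_at b f" x z s, OF d2[OF _ b] convex_ball x xz] s
        by auto
      have xt: "x + t *\<^sub>R z \<in> ball p r" using inB t s by simp
      have "pderiv_at z (pderiv_at b f) (x + t *\<^sub>R z) =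
          (\<Sum>b'\<in>Basis. pderiv_at b' (pderiv_at b f) (x + t *\<^sub>R z) * (z \<bullet> b'))"
        unfolding pderiv_at_eq_gradient[OF d2[OF xt b], of z]
        by (simp add: gradient_def inner_sum_left inner_sum_right inner_commute)
      then have "\<bar>pderiv_at z (pderiv_at b f) (x + t *\<^sub>R z)\<bar> \<le> n * (K * norm z)"
        using sum_bound[of "\<lambda>b'. pderiv_at b' (pderiv_at b f) (x + t *\<^sub>R z)" K z] K[OF b _ xt] by simp
      then have "s * \<bar>pderiv_at z (pderiv_at b f) (x + t *\<^sub>R z)\<bar> \<le> 1 * (n * (K * norm z))"
        using s by (intro mult_mono) auto
      then show ?thesis unfolding t(3) abs_mult using s by simp
    qed
    have xs: "x + s *\<^sub>R z \<in> ball p r" using inB s by simp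
    have "f y - f x - gradient f x \<bullet> (y - x) = gradient f (x + s *\<^sub>R z) \<bullet> z - gradient f x \<bullet> z"
      using s(3) pderiv_at_eq_gradient[OF d1[OF xs], of z] by (simp add: z_def)
    also have "\<dots> = (\<Sum>b\<in>Basis. (pderiv_at b f (x + s *\<^sub>R z) - pderiv_at b f x) * (z \<bullet> b))"
      unfolding gradient_def inner_sum_left
      by (simp add: inner_commute[of z] left_diff_distrib sum_subtractf)
    finally have e: "f y - f x - gradient f x \<bullet> (y - x) = \<dots>" .
    have "\<bar>f y - f x - gradient f x \<bullet> (y - x)\<bar> \<le> n * (n * (K * norm z) * norm z)"
      unfolding e by (rule sum_bound) (rule diff)
    then show ?thesis by (simp add: z_def power2_eq_square mult_ac)
  qed
  then show ?thesis using \<open>K \<ge> 0\<close>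
    by (intro exI[of _ "n * (n * K)"]) (auto simp: n_def)
qed

text \<open>
  Balls of radius \<open>R\<close> on both sides of \<open>\<Omega>\<close> that touch at \<open>q\<close>, with \<open>\<nu>\<close> the inner normal at \<open>q\<close>. This
  is the form in which the regularity of the boundary enters the estimates.
\<close>
definition two_sided_ball :: "'a::euclidean_space set \<Rightarrow> real \<Rightarrow> 'a \<Rightarrow> 'a \<Rightarrow> bool"
  where "two_sided_ball \<Omega> R q \<nu> \<longleftrightarrow> norm \<nu> = 1 \<and>
    ball (q + R *\<^sub>R \<nu>) R \<subseteq> \<Omega> \<and> ball (q - R *\<^sub>R \<nu>) R \<inter> \<Omega> = {}"

text \<open>
  For \<open>y\<close> in one of the two balls, \<open>|y - q|\<^sup>2 < 2 R |\<nu> \<bullet> (y - q)|\<close>. When \<open>R\<close> is small, the linear term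
  in the Taylor expansion of \<open>y \<bullet> e - g y\<close> at \<open>q\<close> therefore exceeds the quadratic remainder and
  determines the sign.
\<close>
lemma graph_two_sided_ball:
  fixes \<Omega> :: "'a::euclidean_space set"
  assumes "open \<Omega>" "r > 0" "0 \<le> \<alpha>" and e: "norm e = 1" and const: "\<And>x t. g (x + t *\<^sub>R e) = g x"
    and g: "Ck_Holder_on 2 \<alpha> g (ball p r)" and \<Omega>: "\<Omega> \<inter> ball p r = {x \<in> ball p r. g x < x \<bullet> e}"
  shows "\<exists>R0>0. \<forall>q\<in>frontier \<Omega> \<inter> ball p (r / 2). \<exists>\<nu>. \<forall>R. 0 < R \<and> R \<le> R0 \<longrightarrow> two_sided_ball \<Omega> R q \<nu>"
proof -
  obtain L where "L \<ge> 0" and L: "\<And>x y. x \<in> ball p r \<Longrightarrow> y \<in> ball p r \<Longrightarrow>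
      \<bar>g y - g x - gradient g x \<bullet> (y - x)\<bar> \<le> L * (norm (y - x))\<^sup>2"
    using quadratic_remainder_bound[OF g \<open>0 \<le> \<alpha>\<close> \<open>r > 0\<close>] by auto
  have diff: "g differentiable (at x)" if "x \<in> ball p r" for x
    using g that by (auto simp: numeral_2_eq_2)
  \<comment> \<open>\<open>R \<le> r / 4\<close> keeps both balls inside the chart \<open>ball p r\<close>, and \<open>2 R (L + 1) \<le> 1\<close> makes
      the linear term dominate the quadratic remainder.\<close>
  define R0 where "R0 = min (r / 4) (1 / (2 * (L + 1)))"
  have "R0 > 0" using \<open>r > 0\<close> \<open>L \<ge> 0\<close> by (simp add: R0_def)
  have "\<exists>\<nu>. \<forall>R. 0 < R \<and> R \<le> R0 \<longrightarrow> two_sided_ball \<Omega> R q \<nu>" if q: "q \<in> frontier \<Omega>" "q \<in> ball p (r / 2)" for q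
  proof -
    have qr: "q \<in> ball p r" using q(2) \<open>r > 0\<close> by auto
    have gq: "g q = q \<bullet> e"
    proof (rule antisym)
      have "q \<notin> \<Omega>" using q(1) \<open>open \<Omega>\<close> by (simp add: frontier_def interior_open)
      then show "q \<bullet> e \<le> g q" using \<Omega> qr by force
      show "g q \<le> q \<bullet> e"
      proof (rule ccontr)
        assume "\<not> g q \<le> q \<bullet> e"
        have "isCont (\<lambda>y. g y - y \<bullet> e) q"
          using differentiable_imp_continuous_within[OF diff[OF qr]] by (intro continuous_intros) auto
        then have "\<forall>\<^sub>F y in at q. 0 < g y - y \<bullet> e"
          using \<open>\<not> g q \<le> q \<bullet> e\<close> by (intro order_tendstoD(1)[of _ "g q - q \<bullet> e"]) (auto simp: isCont_def)
        moreover have "\<forall>\<^sub>F y in at q. y \<in> ball p r"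
          using qr by (intro eventually_at_in_open') auto
        ultimately have "\<forall>\<^sub>F y in at q. y \<notin> \<Omega>"
          by (rule eventually_elim2) (use \<Omega> in force)
        then have "\<not> q islimpt \<Omega>" by (simp add: islimpt_iff_eventually)
        then show False using q(1) \<open>q \<notin> \<Omega>\<close> by (simp add: frontier_def closure_def)
      qed
    qed
    define a where "a = e - gradient g q"
    define \<nu> where "\<nu> = sgn a"
    \<comment> \<open>\<open>a\<close> is the gradient of the defining function \<open>y \<bullet> e - g y\<close> at \<open>q\<close>. Its \<open>e\<close>-component is 1
        because \<open>g\<close> does not depend on the \<open>e\<close>-coordinate, so it is at least a unit vector.\<close>
    have "pderiv_at e g q = 0"
      using DERIV_unique[of "\<lambda>_. g q" "pderiv_at e g q" 0 0] has_derivative_along_line[of g q 0 e]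
        diff[OF qr] DERIV_const[of "g q" "at 0"]
      by (simp add: const)
    then have "a \<bullet> e = 1"
      using e pderiv_at_eq_gradient[OF diff[OF qr], of e] by (simp add: a_def inner_diff_left dot_square_norm)
    then have na: "norm a \<ge> 1" using Cauchy_Schwarz_ineq2[of a e] e by simp
    then have "a \<noteq> 0" by auto
    then have \<nu>: "norm \<nu> = 1" "a = norm a *\<^sub>R \<nu>" by (simp_all add: \<nu>_def norm_sgn) (simp add: sgn_div_norm)
    then have \<nu>\<nu>: "\<nu> \<bullet> \<nu> = 1" by (simp add: dot_square_norm)
    have expand: "(norm (z - t *\<^sub>R \<nu>))\<^sup>2 = (norm z)\<^sup>2 - 2 * t * (\<nu> \<bullet> z) + t * t" for z t
      unfolding power2_norm_eq_inner inner_diff_left inner_diff_right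
      by (simp add: \<nu>\<nu> inner_commute)
    have G: "\<bar>(y \<bullet> e - g y) - a \<bullet> (y - q)\<bar> \<le> L * (norm (y - q))\<^sup>2" if "y \<in> ball p r" for y
      using L[OF qr that] unfolding a_def by (simp add: gq inner_diff_left inner_diff_right inner_commute abs_if split: if_splits)
    have close: "y \<in> ball p r" and cone: "(norm (y - q))\<^sup>2 < 2 * R * (\<sigma> * (\<nu> \<bullet> (y - q)))"
      if "y \<in> ball (q + (\<sigma> * R) *\<^sub>R \<nu>) R" "\<bar>\<sigma>\<bar> = 1" "0 < R" "R \<le> R0" for y R \<sigma>
    proof -
      have ny: "norm (y - q - (\<sigma> * R) *\<^sub>R \<nu>) < R"
        using that(1) by (simp add: dist_norm norm_minus_commute algebra_simps)
      have "norm (y - q) \<le> norm (y - q - (\<sigma> * R) *\<^sub>R \<nu>) + norm ((\<sigma> * R) *\<^sub>R \<nu>)"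
        using norm_triangle_ineq[of "y - q - (\<sigma> * R) *\<^sub>R \<nu>" "(\<sigma> * R) *\<^sub>R \<nu>"] by simp
      also have "\<dots> < 2 * R" using ny that \<nu> by (simp add: abs_mult)
      finally have "dist p y < r / 2 + 2 * R"
        using dist_triangle[of p y q] q(2) by (simp add: dist_norm norm_minus_commute)
      then show "y \<in> ball p r" using that(4) by (simp add: R0_def)
      have "\<sigma> * \<sigma> = 1" using that(2) by (metis abs_mult_self_eq mult_1)
      have "(norm (y - q - (\<sigma> * R) *\<^sub>R \<nu>))\<^sup>2 < R\<^sup>2" using ny by (simp add: power_strict_mono)
      moreover have "\<sigma> * R * (\<sigma> * R) = (\<sigma> * \<sigma>) * R\<^sup>2" by (simp add: power2_eq_square)
      ultimately show "(norm (y - q))\<^sup>2 < 2 * R * (\<sigma> * (\<nu> \<bullet> (y - q)))"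
        unfolding expand \<open>\<sigma> * \<sigma> = 1\<close> by (simp add: mult_ac)
    qed
    \<comment> \<open>With \<open>\<sigma> = 1\<close> this is the ball on the side of \<open>\<Omega>\<close>, with \<open>\<sigma> = - 1\<close> the opposite one.\<close>
    have sign: "\<sigma> * (y \<bullet> e - g y) > 0"
      if y: "y \<in> ball (q + (\<sigma> * R) *\<^sub>R \<nu>) R" and \<sigma>: "\<bar>\<sigma>\<bar> = 1" and R: "0 < R" "R \<le> R0" for y R \<sigma>
    proof -
      define N where "N = (norm (y - q))\<^sup>2"
      define m where "m = \<sigma> * (\<nu> \<bullet> (y - q))"
      have "N < 2 * R * m" using cone[OF y \<sigma> R] by (simp add: N_def m_def)
      have "N \<ge> 0" by (simp add: N_def)
      then have "m > 0" using \<open>N < 2 * R * m\<close> R by (smt (verit) mult_nonneg_nonpos)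
      have "2 * R * (L + 1) \<le> 1"
        using R(2) \<open>L \<ge> 0\<close> by (simp add: R0_def field_simps)
      have "L * N \<le> (L + 1) * N" using \<open>N \<ge> 0\<close> by (simp add: mult_right_mono)
      also have "\<dots> < (L + 1) * (2 * R * m)" using \<open>N < 2 * R * m\<close> \<open>L \<ge> 0\<close> by simp
      also have "\<dots> = (2 * R * (L + 1)) * m" by (simp add: mult_ac)
      also have "\<dots> \<le> 1 * m" using \<open>2 * R * (L + 1) \<le> 1\<close> \<open>m > 0\<close> by (intro mult_right_mono) auto
      also have "\<dots> \<le> norm a * m" using na \<open>m > 0\<close> by (intro mult_right_mono) auto
      also have "\<dots> = \<sigma> * (a \<bullet> (y - q))" by (subst \<nu>(2)) (simp add: m_def mult_ac)
      finally have "L * N < \<sigma> * (a \<bullet> (y - q))" .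
      moreover have "\<bar>\<sigma> * ((y \<bullet> e - g y) - a \<bullet> (y - q))\<bar> \<le> L * N"
        unfolding abs_mult \<sigma> using G[OF close[OF y \<sigma> R]] by (simp add: N_def)
      ultimately show ?thesis by (simp add: right_diff_distrib abs_le_iff)
    qed
    have "two_sided_ball \<Omega> R q \<nu>" if R: "0 < R" "R \<le> R0" for R
      unfolding two_sided_ball_def
    proof (intro conjI)
      show "norm \<nu> = 1" by (rule \<nu>)
      show "ball (q + R *\<^sub>R \<nu>) R \<subseteq> \<Omega>"
        using sign[of _ 1 R] close[of _ 1 R] R \<Omega> by force
      show "ball (q - R *\<^sub>R \<nu>) R \<inter> \<Omega> = {}"
        using sign[of _ "-1" R] close[of _ "-1" R] R \<Omega> by force
    qed
    then show ?thesis by blast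
  qed
  then show ?thesis using \<open>R0 > 0\<close> by blast
qed

text \<open>
  The frontier is compact and the condition is inherited by smaller radii, so finitely many charts
  give a common radius.
\<close>
lemma uniform_two_sided_ball:
  fixes \<Omega> :: "'a::euclidean_space set"
  assumes dom: "bounded_domain_of_class 2 \<alpha> \<Omega>" and "0 \<le> \<alpha>"
  obtains R where "R > 0" "\<And>q. q \<in> frontier \<Omega> \<Longrightarrow> \<exists>\<nu>. two_sided_ball \<Omega> R q \<nu>"
proof -
  have \<Omega>: "open \<Omega>" "bounded \<Omega>" using dom by (auto simp: bounded_domain_of_class_def)
  have "\<exists>s>0. \<exists>R0>0. \<forall>q\<in>frontier \<Omega> \<inter> ball p s. \<exists>\<nu>. \<forall>R. 0 < R \<and> R \<le> R0 \<longrightarrow> two_sided_ball \<Omega> R q \<nu>"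
    if "p \<in> frontier \<Omega>" for p
  proof -
    have "\<exists>r>0. \<exists>e g. norm e = 1 \<and> (\<forall>x t. g (x + t *\<^sub>R e) = g x) \<and> Ck_Holder_on 2 \<alpha> g (ball p r) \<and>
        \<Omega> \<inter> ball p r = {x \<in> ball p r. g x < x \<bullet> e}"
      using dom that unfolding bounded_domain_of_class_def by blast
    then obtain r e g where "r > 0" "norm e = 1" "\<And>x t. g (x + t *\<^sub>R e) = g x" "Ck_Holder_on 2 \<alpha> g (ball p r)"
      "\<Omega> \<inter> ball p r = {x \<in> ball p r. g x < x \<bullet> e}"
      by (elim exE conjE) blast
    from graph_two_sided_ball[OF \<Omega>(1) this(1) \<open>0 \<le> \<alpha>\<close> this(2-5)] show ?thesis
      using \<open>r > 0\<close> half_gt_zero by blast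
  qed
  then obtain s R0 where s: "\<And>p. p \<in> frontier \<Omega> \<Longrightarrow> s p > 0" and R0: "\<And>p. p \<in> frontier \<Omega> \<Longrightarrow> R0 p > 0"
    and tb: "\<And>p q. p \<in> frontier \<Omega> \<Longrightarrow> q \<in> frontier \<Omega> \<inter> ball p (s p) \<Longrightarrow>
      \<exists>\<nu>. \<forall>R. 0 < R \<and> R \<le> R0 p \<longrightarrow> two_sided_ball \<Omega> R q \<nu>"
    by metis
  have "frontier \<Omega> \<subseteq> (\<Union>p\<in>frontier \<Omega>. ball p (s p))" using s by force
  from compactE_image[OF compact_frontier_bounded[OF \<Omega>(2)] _ this]
  obtain T where T: "T \<subseteq> frontier \<Omega>" "finite T" "frontier \<Omega> \<subseteq> (\<Union>p\<in>T. ball p (s p))"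
    by auto
  define R where "R = Min (insert 1 (R0 ` T))"
  have "R > 0" using T R0 by (auto simp: R_def)
  moreover have "\<exists>\<nu>. two_sided_ball \<Omega> R q \<nu>" if q: "q \<in> frontier \<Omega>" for q
  proof -
    obtain p where p: "p \<in> T" "q \<in> ball p (s p)" using T(3) q by auto
    moreover have "R \<le> R0 p" using p T by (simp add: R_def)
    ultimately show ?thesis using tb[of p q] T(1) q \<open>R > 0\<close> by blast
  qed
  ultimately show ?thesis using that by blast
qed

section \<open>The distance to the boundary\<close>

text \<open>
  A ball is connected, so it cannot leave \<open>\<Omega>\<close> without meeting the frontier.
\<close>
lemma ball_infdist_frontier_subset:
  fixes \<Omega> :: "'a::euclidean_space set"
  assumes "x \<in> \<Omega>"
  shows "ball x (infdist x (frontier \<Omega>)) \<subseteq> \<Omega>"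
proof (rule ccontr)
  assume neg: "\<not> ?thesis"
  define d where "d = infdist x (frontier \<Omega>)"
  have nonempty: "ball x d \<inter> \<Omega> \<noteq> {}"
  proof (cases "d > 0")
    case True
    then show ?thesis using assms centre_in_ball by blast
  next
    case False
    then have "ball x (infdist x (frontier \<Omega>)) = {}" by (simp add: d_def)
    then show ?thesis using neg by blast
  qed
  have "ball x d - \<Omega> \<noteq> {}" using neg by (auto simp: d_def)
  from connected_Int_frontier[OF connected_ball nonempty this]
  obtain p where "p \<in> frontier \<Omega>" "dist x p < d" by auto
  then show False using infdist_le[of p "frontier \<Omega>" x] by (simp add: d_def)
qed

text \<open>
  The ball about \<open>x\<close> of radius \<open>dist x q\<close> lies in \<open>\<Omega>\<close> and hence misses the exterior ball at \<open>q\<close>.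
  Both touch at \<open>q\<close>, so the centres and \<open>q\<close> are aligned: equality in the triangle inequality.
\<close>
lemma nearest_point_normal:
  fixes \<Omega> :: "'a::euclidean_space set"
  assumes q: "q \<in> frontier \<Omega>" "infdist x (frontier \<Omega>) = dist x q"
    and tb: "two_sided_ball \<Omega> R q \<nu>" and "x \<in> \<Omega>" "dist x q > 0" "R > 0"
  shows "x = q + dist x q *\<^sub>R \<nu>"
proof -
  define d where "d = dist x q"
  define D where "D = norm (x - (q - R *\<^sub>R \<nu>))"
  have \<nu>: "\<nu> \<bullet> \<nu> = 1" using tb by (simp add: two_sided_ball_def dot_square_norm)
  have d: "d > 0" "(x - q) \<bullet> (x - q) = d\<^sup>2"
    using assms by (auto simp: d_def dist_norm power2_norm_eq_inner)
  have ge: "D \<ge> R + d"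
  proof (rule ccontr)
    assume "\<not> R + d \<le> D"
    \<comment> \<open>Otherwise \<open>ball x d\<close> and the exterior ball overlap; \<open>y\<close> divides the segment between the
        centres in the ratio of the radii.\<close>
    define l where "l = R / (R + d)"
    define y where "y = (q - R *\<^sub>R \<nu>) + l *\<^sub>R (x - (q - R *\<^sub>R \<nu>))"
    have l: "l > 0" "1 - l = d / (R + d)" "1 - l > 0"
      using d(1) \<open>R > 0\<close> by (auto simp: l_def field_simps)
    have "y - (q - R *\<^sub>R \<nu>) = l *\<^sub>R (x - (q - R *\<^sub>R \<nu>))" by (simp add: y_def)
    then have "norm (y - (q - R *\<^sub>R \<nu>)) = l * D" using l by (simp add: D_def)
    also have "\<dots> < l * (R + d)" using l \<open>\<not> R + d \<le> D\<close> by simp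
    also have "\<dots> = R" using d(1) \<open>R > 0\<close> by (simp add: l_def)
    finally have 1: "y \<in> ball (q - R *\<^sub>R \<nu>) R" by (simp add: dist_norm norm_minus_commute)
    have "x - y = (1 - l) *\<^sub>R (x - (q - R *\<^sub>R \<nu>))" by (simp add: y_def algebra_simps)
    then have "norm (x - y) = (1 - l) * D" using l(3) by (simp add: D_def)
    also have "\<dots> < (1 - l) * (R + d)" using l(3) \<open>\<not> R + d \<le> D\<close> by simp
    also have "\<dots> = d" using d(1) \<open>R > 0\<close> by (simp add: l)
    finally have "y \<in> ball x (infdist x (frontier \<Omega>))" by (simp add: dist_norm d_def q(2))
    then have "y \<in> \<Omega>" using ball_infdist_frontier_subset[OF \<open>x \<in> \<Omega>\<close>] by auto
    then show False using 1 tb by (auto simp: two_sided_ball_def)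
  qed
  have "(R + d)\<^sup>2 \<le> D\<^sup>2" using ge d \<open>R > 0\<close> by (intro power_mono) auto
  also have "D\<^sup>2 = ((x - q) + R *\<^sub>R \<nu>) \<bullet> ((x - q) + R *\<^sub>R \<nu>)"
    unfolding D_def power2_norm_eq_inner by (simp add: algebra_simps)
  also have "\<dots> = d\<^sup>2 + 2 * R * ((x - q) \<bullet> \<nu>) + R\<^sup>2"
    unfolding inner_add_left inner_add_right d(2)
    by (simp add: \<nu> inner_commute power2_eq_square)
  finally have "R * d \<le> R * ((x - q) \<bullet> \<nu>)" by (simp add: power2_sum)
  then have "d \<le> (x - q) \<bullet> \<nu>" using \<open>R > 0\<close> by simp
  moreover have "((x - q) - d *\<^sub>R \<nu>) \<bullet> ((x - q) - d *\<^sub>R \<nu>) = 2 * d\<^sup>2 - 2 * d * ((x - q) \<bullet> \<nu>)"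
    unfolding inner_diff_left[of "x - q"] inner_diff_right[of _ "x - q"] d(2)
    by (simp add: \<nu> inner_commute power2_eq_square)
  moreover have "2 * d\<^sup>2 = 2 * d * d" by (simp add: power2_eq_square)
  ultimately have "((x - q) - d *\<^sub>R \<nu>) \<bullet> ((x - q) - d *\<^sub>R \<nu>) \<le> 0" using d(1) by simp
  then have "(x - q) - d *\<^sub>R \<nu> = 0" by (metis inner_gt_zero_iff not_less)
  then show ?thesis by (simp add: d_def algebra_simps)
qed

lemma has_derivative_sandwich:
  fixes f g h :: "'a::real_normed_vector \<Rightarrow> real"
  assumes f: "(f has_derivative D) (at x)" and h: "(h has_derivative D) (at x)"
    and le: "\<And>y. f y \<le> g y" "\<And>y. g y \<le> h y" and "f x = h x"
  shows "(g has_derivative D) (at x)"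
  unfolding has_derivative_at_alt
proof (intro conjI allI impI)
  show "bounded_linear D" using f by (rule has_derivative_bounded_linear)
  fix e :: real assume "e > 0"
  obtain d1 where d1: "d1 > 0" "\<And>y. norm (y - x) < d1 \<Longrightarrow> norm (f y - f x - D (y - x)) \<le> e * norm (y - x)"
    using f \<open>e > 0\<close> unfolding has_derivative_at_alt by blast
  obtain d2 where d2: "d2 > 0" "\<And>y. norm (y - x) < d2 \<Longrightarrow> norm (h y - h x - D (y - x)) \<le> e * norm (y - x)"
    using h \<open>e > 0\<close> unfolding has_derivative_at_alt by blast
  have gx: "g x = f x" "g x = h x" using le[of x] \<open>f x = h x\<close> by auto
  have "norm (g y - g x - D (y - x)) \<le> e * norm (y - x)" if "norm (y - x) < min d1 d2" for y
    using d1(2)[of y] d2(2)[of y] le[of y] gx that unfolding real_norm_def by auto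
  then show "\<exists>d>0. \<forall>y. norm (y - x) < d \<longrightarrow> norm (g y - g x - D (y - x)) \<le> e * norm (y - x)"
    using d1(1) d2(1) by (intro exI[of _ "min d1 d2"]) auto
qed

text \<open>
  The distance to the frontier lies between the signed distance to the sphere that bounds the interior
  ball and the distance to \<open>q\<close>. These agree at the point and have the same derivative there.
\<close>
lemma infdist_frontier_has_derivative:
  fixes \<Omega> :: "'a::euclidean_space set"
  assumes "open \<Omega>" and q: "q \<in> frontier \<Omega>" and tb: "two_sided_ball \<Omega> R q \<nu>"
    and "0 < s" "s < R"
  shows "((\<lambda>y. infdist y (frontier \<Omega>)) has_derivative (\<lambda>h. h \<bullet> \<nu>)) (at (q + s *\<^sub>R \<nu>))"
proof (rule has_derivative_sandwich[where f = "\<lambda>y. R - norm (y - (q + R *\<^sub>R \<nu>))" and h = "\<lambda>y. norm (y - q)"])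
  have \<nu>: "norm \<nu> = 1" using tb by (simp add: two_sided_ball_def)
  then have "\<nu> \<noteq> 0" by auto
  let ?x = "q + s *\<^sub>R \<nu>" and ?c = "q + R *\<^sub>R \<nu>"
  have xc: "?x - ?c = (s - R) *\<^sub>R \<nu>" by (simp add: algebra_simps)
  have "sgn (?x - ?c) = sgn (s - R) *\<^sub>R sgn \<nu>" unfolding xc by (rule sgn_scaleR)
  then have sgn: "sgn (?x - ?c) = - \<nu>" "sgn (?x - q) = \<nu>"
    using assms \<nu> by (simp_all add: sgn_scaleR sgn_div_norm[of \<nu>])
  have chain: "((\<lambda>y. norm (y - a)) has_derivative (\<lambda>h. h \<bullet> sgn (?x - a))) (at ?x)" if "?x - a \<noteq> 0" for a
  proof -
    have "((\<lambda>y. y - a) has_derivative (\<lambda>h. h)) (at ?x)" by (auto intro!: derivative_eq_intros)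
    from diff_chain_at[OF this has_derivative_norm[OF that]] show ?thesis by (simp add: o_def)
  qed
  show "((\<lambda>y. norm (y - q)) has_derivative (\<lambda>h. h \<bullet> \<nu>)) (at ?x)"
    using chain[of q] \<open>\<nu> \<noteq> 0\<close> \<open>0 < s\<close> sgn by simp
  have "((\<lambda>y. norm (y - ?c)) has_derivative (\<lambda>h. h \<bullet> - \<nu>)) (at ?x)"
    using chain[of ?c] \<open>\<nu> \<noteq> 0\<close> \<open>s < R\<close> sgn by (auto simp: xc)
  from has_derivative_diff[OF has_derivative_const[of R] this]
  show "((\<lambda>y. R - norm (y - ?c)) has_derivative (\<lambda>h. h \<bullet> \<nu>)) (at ?x)" by simp
  show "R - norm (y - ?c) \<le> infdist y (frontier \<Omega>)" for y
  proof -
    have "R - norm (y - ?c) \<le> dist y p" if "p \<in> frontier \<Omega>" for p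
    proof -
      have "p \<notin> \<Omega>" using that \<open>open \<Omega>\<close> by (simp add: frontier_def interior_open)
      then have "p \<notin> ball ?c R" using tb unfolding two_sided_ball_def by blast
      then have "R \<le> dist ?c p" by simp
      also have "\<dots> \<le> dist ?c y + dist y p" by (rule dist_triangle)
      finally show ?thesis by (simp add: dist_norm norm_minus_commute)
    qed
    then show ?thesis using q unfolding infdist_def by (auto intro!: cINF_greatest)
  qed
  show "infdist y (frontier \<Omega>) \<le> norm (y - q)" for y
    using infdist_le[OF q] by (simp add: dist_norm)
  show "R - norm (?x - ?c) = norm (?x - q)" unfolding xc using assms \<nu> by simp
qed

section \<open>The hyperbolic radius near the boundary\<close>

lemma power_of_ball_solution:
  fixes n :: real
  assumes "n > 2" "A > 0"
  shows "((1 / A) powr ((n - 2) / 2)) powr (- 2 / (n - 2)) = A"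
proof -
  have e: "(n - 2) / 2 * (- 2 / (n - 2)) = - 1" using assms by (simp add: field_simps)
  show ?thesis using assms by (simp only: powr_powr e) (simp add: powr_minus_divide)
qed

text \<open>
  The explicit solutions in the interior ball and outside the exterior ball have hyperbolic radii
  \<open>2 s - s\<^sup>2 / R\<close> and \<open>2 s + s\<^sup>2 / R\<close> at distance \<open>s\<close> from the common point \<open>q\<close> of the two spheres.
\<close>
lemma hyperbolic_radius_estimate:
  fixes \<Omega> :: "'a::euclidean_space set"
  assumes dim: "DIM('a) \<ge> 3" and "open \<Omega>" and u: "maximal_solution \<Omega> u"
    and q: "q \<in> frontier \<Omega>" and tb: "two_sided_ball \<Omega> R q \<nu>"
    and s: "0 < s" "s < R" "q + s *\<^sub>R \<nu> \<in> \<Omega>"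
  shows "\<bar>u (q + s *\<^sub>R \<nu>) powr (- 2 / (real DIM('a) - 2)) - 2 * s\<bar> \<le> s\<^sup>2 / R"
proof -
  define n where "n = real DIM('a)"
  define x where "x = q + s *\<^sub>R \<nu>"
  have n: "n > 2" using dim by (simp add: n_def)
  have \<nu>: "norm \<nu> = 1" using tb by (simp add: two_sided_ball_def)
  have R: "R > 0" using s by simp
  have uc: "classical_solution \<Omega> u" using u by (simp add: maximal_solution_def)
  have "u x > 0" using uc s(3) by (simp add: classical_solution_def x_def)
  have "x - (q + R *\<^sub>R \<nu>) = (s - R) *\<^sub>R \<nu>" by (simp add: x_def algebra_simps)
  then have nc: "norm (x - (q + R *\<^sub>R \<nu>)) = R - s" using \<nu> s by simp
  have "x - (q - R *\<^sub>R \<nu>) = (s + R) *\<^sub>R \<nu>" by (simp add: x_def algebra_simps)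
  then have nc': "norm (x - (q - R *\<^sub>R \<nu>)) = s + R" using \<nu> s by simp
  define A where "A = 2 * s - s\<^sup>2 / R"
  have "s\<^sup>2 / R < s" using s by (simp add: power2_eq_square divide_less_eq)
  then have "A > 0" using s by (simp add: A_def)
  have "x \<in> ball (q + R *\<^sub>R \<nu>) R" using nc s by (simp add: dist_norm norm_minus_commute)
  then have "u x \<le> ball_solution (- 1) (q + R *\<^sub>R \<nu>) R x"
    using tb by (intro classical_solution_le_ball_solution[OF dim uc]) (auto simp: two_sided_ball_def)
  also have "\<dots> = (1 / A) powr ((n - 2) / 2)"
  proof -
    have "- 1 * ((R - s)\<^sup>2 - R\<^sup>2) = R * A"
      using R by (simp add: A_def power2_eq_square field_simps)
    then show ?thesis unfolding ball_solution_def nc n_def[symmetric] using R by simp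
  qed
  finally have "((1 / A) powr ((n - 2) / 2)) powr (- 2 / (n - 2)) \<le> u x powr (- 2 / (n - 2))"
    using n \<open>u x > 0\<close> by (intro powr_mono2') (auto simp: divide_nonpos_pos)
  then have lower: "A \<le> u x powr (- 2 / (n - 2))"
    unfolding power_of_ball_solution[OF n \<open>A > 0\<close>] .
  define B where "B = 2 * s + s\<^sup>2 / R"
  have "B > 0" using s by (simp add: B_def add_pos_nonneg)
  have eq: "ball_solution 1 (q - R *\<^sub>R \<nu>) R x = (1 / B) powr ((n - 2) / 2)"
  proof -
    have "1 * ((s + R)\<^sup>2 - R\<^sup>2) = R * B"
      using R by (simp add: B_def power2_eq_square field_simps)
    then show ?thesis unfolding ball_solution_def nc' n_def[symmetric] using R by simp
  qed
  have "ball_solution 1 (q - R *\<^sub>R \<nu>) R x \<le> u x"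
    using tb s(3) by (intro ball_solution_le_maximal_solution[OF dim u \<open>open \<Omega>\<close> R])
      (auto simp: two_sided_ball_def x_def)
  then have "u x powr (- 2 / (n - 2)) \<le> ((1 / B) powr ((n - 2) / 2)) powr (- 2 / (n - 2))"
    unfolding eq using n \<open>B > 0\<close> by (intro powr_mono2') (auto simp: divide_nonpos_pos)
  then have upper: "u x powr (- 2 / (n - 2)) \<le> B"
    unfolding power_of_ball_solution[OF n \<open>B > 0\<close>] .
  show ?thesis
    using lower upper unfolding A_def B_def n_def x_def by (simp add: abs_le_iff)
qed

text \<open>
  Every point at positive distance from the frontier has a nearest frontier point, and it lies on the
  inner normal there. The estimates at touching balls and the interior gradient estimate on a ball of
  half the distance then apply.
\<close>
lemma hyperbolic_radius_near_frontier:
  fixes \<Omega> :: "'a::euclidean_space set"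
  assumes dim: "DIM('a) \<ge> 3" and \<Omega>: "open \<Omega>" "frontier \<Omega> \<noteq> {}"
    and R: "R > 0" "\<And>q. q \<in> frontier \<Omega> \<Longrightarrow> \<exists>\<nu>. two_sided_ball \<Omega> R q \<nu>"
    and v: "hyperbolic_radius \<Omega> v" and d_def: "d = (\<lambda>x. infdist x (frontier \<Omega>))"
  obtains C where "\<And>x. x \<in> \<Omega> \<Longrightarrow> 0 < d x \<Longrightarrow> d x < R / 2 \<Longrightarrow>
      \<bar>v x - 2 * d x\<bar> \<le> (d x)\<^sup>2 / R \<and>
      (\<exists>d'. (d has_derivative d') (at x) \<and> (\<forall>b\<in>Basis. \<bar>d' b\<bar> \<le> 1)) \<and>
      (\<exists>v'. (v has_derivative v') (at x) \<and> (\<forall>b\<in>Basis. \<bar>v' b\<bar> \<le> C))"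
proof -
  define n where "n = real DIM('a)"
  define C where "C = 2 / (n - 2) * 6 powr (n / 2) * (n + 1 + n * (n - 2) / 2)"
  obtain u where u: "maximal_solution \<Omega> u" and vu: "\<And>x. x \<in> \<Omega> \<Longrightarrow> v x = u x powr (- 2 / (n - 2))"
    using v unfolding hyperbolic_radius_def n_def by auto
  have uc: "classical_solution \<Omega> u" using u by (simp add: maximal_solution_def)
  have foot: "\<exists>q\<in>frontier \<Omega>. \<exists>\<nu>. two_sided_ball \<Omega> R q \<nu> \<and> x = q + d x *\<^sub>R \<nu>"
    if "x \<in> \<Omega>" "0 < d x" for x
  proof -
    obtain q where q: "q \<in> frontier \<Omega>" "infdist x (frontier \<Omega>) = dist x q"
      using infdist_attains_inf[OF frontier_closed \<Omega>(2)] by blast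
    obtain \<nu> where tb: "two_sided_ball \<Omega> R q \<nu>" using R(2) q(1) by blast
    have "x = q + d x *\<^sub>R \<nu>"
      using nearest_point_normal[OF q tb that(1) _ R(1)] that(2) q(2) by (simp add: d_def)
    then show ?thesis using q(1) tb by blast
  qed
  have est: "\<bar>v x - 2 * d x\<bar> \<le> (d x)\<^sup>2 / R" if x: "x \<in> \<Omega>" "0 < d x" "d x < R" for x
  proof -
    obtain q \<nu> where q: "q \<in> frontier \<Omega>" "two_sided_ball \<Omega> R q \<nu>" "x = q + d x *\<^sub>R \<nu>"
      using foot x by blast
    have "\<bar>u (q + d x *\<^sub>R \<nu>) powr (- 2 / (n - 2)) - 2 * d x\<bar> \<le> (d x)\<^sup>2 / R"
      unfolding n_def
      by (rule hyperbolic_radius_estimate[OF dim \<Omega>(1) u q(1,2) x(2,3)]) (use q(3) x(1) in metis)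
    then show ?thesis unfolding q(3)[symmetric] vu[OF x(1)] .
  qed
  have "(\<exists>d'. (d has_derivative d') (at x) \<and> (\<forall>b\<in>Basis. \<bar>d' b\<bar> \<le> 1)) \<and>
      (\<exists>v'. (v has_derivative v') (at x) \<and> (\<forall>b\<in>Basis. \<bar>v' b\<bar> \<le> C))"
    if x: "x \<in> \<Omega>" "0 < d x" "d x < R / 2" for x
  proof
    obtain q \<nu> where q: "q \<in> frontier \<Omega>" "two_sided_ball \<Omega> R q \<nu>" "x = q + d x *\<^sub>R \<nu>"
      using foot x by blast
    have "(d has_derivative (\<lambda>h. h \<bullet> \<nu>)) (at (q + d x *\<^sub>R \<nu>))"
      unfolding d_def
      by (rule infdist_frontier_has_derivative[OF \<Omega>(1) q(1,2)]) (use x R(1) in \<open>auto simp: d_def\<close>)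
    then have "(d has_derivative (\<lambda>h. h \<bullet> \<nu>)) (at x)" unfolding q(3)[symmetric] .
    moreover have "\<bar>b \<bullet> \<nu>\<bar> \<le> 1" if "b \<in> Basis" for b
      using Basis_le_norm[OF that, of \<nu>] q(2) by (simp add: two_sided_ball_def inner_commute)
    ultimately show "\<exists>d'. (d has_derivative d') (at x) \<and> (\<forall>b\<in>Basis. \<bar>d' b\<bar> \<le> 1)" by blast
  next
    define \<rho> where "\<rho> = d x / 2"
    have \<rho>: "\<rho> > 0" "d x = 2 * \<rho>" "4 * \<rho> < R" using x by (auto simp: \<rho>_def)
    \<comment> \<open>Half the distance to the frontier: on \<open>cball x \<rho>\<close> the distance lies between \<open>\<rho>\<close> and
        \<open>3 \<rho> < R\<close>, so that the estimate of \<open>v\<close> is available there.\<close>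
    have sub: "cball x \<rho> \<subseteq> \<Omega>"
      using ball_infdist_frontier_subset[OF x(1)] \<rho> by (force simp: d_def subset_iff)
    have ge: "\<rho> \<le> u y powr (- 2 / (n - 2))" if y: "y \<in> cball x \<rho>" for y
    proof -
      have dy: "\<rho> \<le> d y" "d y \<le> 3 * \<rho>"
        using infdist_triangle[of x "frontier \<Omega>" y] infdist_triangle[of y "frontier \<Omega>" x] y \<rho>(2)
        by (auto simp: d_def dist_commute)
      have "y \<in> \<Omega>" using y sub by auto
      have "(d y)\<^sup>2 / R \<le> d y"
        using dy \<rho> R(1) by (simp add: power2_eq_square divide_le_eq)
      then show ?thesis
        using est[OF \<open>y \<in> \<Omega>\<close>] vu[OF \<open>y \<in> \<Omega>\<close>] dy \<rho> by (simp add: abs_le_iff)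
    qed
    have le: "u x powr (- 2 / (n - 2)) \<le> 6 * \<rho>"
    proof -
      have "(d x)\<^sup>2 / R \<le> d x"
        using x R(1) by (simp add: power2_eq_square divide_le_eq)
      then show ?thesis
        using est[of x] vu[OF x(1)] x \<rho>(2) R(1) by (simp add: abs_le_iff)
    qed
    have "u x > 0" using uc x(1) by (simp add: classical_solution_def)
    have "u differentiable (at x)"
      using uc x(1) by (auto simp: classical_solution_def intro: Ck_on_2D(1))
    then have du: "(u has_derivative (\<lambda>h. pderiv_at h u x)) (at x)"
      unfolding pderiv_at_def by (simp add: frechet_derivative_works)
    have "((\<lambda>t. t powr (- 2 / (n - 2))) has_derivative (*) (- 2 / (n - 2) * u x powr (- 2 / (n - 2) - 1))) (at (u x))"
      using has_real_derivative_powr[OF \<open>u x > 0\<close>] unfolding has_field_derivative_def .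
    from diff_chain_at[OF du this]
    have "((\<lambda>y. u y powr (- 2 / (n - 2))) has_derivative
        (\<lambda>h. - 2 / (n - 2) * u x powr (- 2 / (n - 2) - 1) * pderiv_at h u x)) (at x)"
      by (simp add: o_def)
    from has_derivative_transform_within_open[OF this \<Omega>(1) x(1)] vu
    have "(v has_derivative (\<lambda>h. - 2 / (n - 2) * u x powr (- 2 / (n - 2) - 1) * pderiv_at h u x)) (at x)"
      by simp
    moreover have "\<bar>- 2 / (n - 2) * u x powr (- 2 / (n - 2) - 1) * pderiv_at b u x\<bar> \<le> C"
      if b: "b \<in> Basis" for b
      unfolding C_def
      by (rule solution_pderiv_bound[OF dim uc sub \<rho>(1) _ _ b n_def]) (use ge le n_def in auto)
    ultimately show "\<exists>v'. (v has_derivative v') (at x) \<and> (\<forall>b\<in>Basis. \<bar>v' b\<bar> \<le> C)" by blast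
  qed
  then show ?thesis using est R(1) by (intro that[of C]) auto
qed

text \<open>
  The weight \<open>d\<^sup>2\<close> cancels the denominator in the derivative of \<open>(v - 2 d) / d\<^sup>2\<close>, except for one
  factor \<open>1 / d\<close> on the small quantity \<open>v - 2 d\<close>. So a bound on \<open>\<nabla>v\<close> is all that is required.
\<close>
lemma pderiv_at_weighted_difference:
  fixes v d :: "'a::euclidean_space \<Rightarrow> real"
  assumes v: "(v has_derivative v') (at x)" and d: "(d has_derivative d') (at x)" and "d x > 0"
  shows "(\<lambda>y. (v y - 2 * d y) / (d y)\<^sup>2) differentiable (at x)"
    and "(d x)\<^sup>2 * pderiv_at b (\<lambda>y. (v y - 2 * d y) / (d y)\<^sup>2) x
      = v' b - 2 * d' b - 2 * ((v x - 2 * d x) / d x) * d' b"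
proof -
  have "((\<lambda>y. v y - 2 * d y) has_derivative (\<lambda>h. v' h - 2 * d' h)) (at x)"
    by (intro has_derivative_diff has_derivative_mult_right v d)
  moreover have "((\<lambda>y. (d y)\<^sup>2) has_derivative (\<lambda>h. 2 * d x * d' h)) (at x)"
    using has_derivative_power[OF d, of 2] by (simp add: mult_ac)
  ultimately have D: "((\<lambda>y. (v y - 2 * d y) / (d y)\<^sup>2) has_derivative
      (\<lambda>h. ((v' h - 2 * d' h) * (d x)\<^sup>2 - (v x - 2 * d x) * (2 * d x * d' h)) / ((d x)\<^sup>2 * (d x)\<^sup>2))) (at x)"
    using \<open>d x > 0\<close> by (intro has_derivative_divide') auto
  then show "(\<lambda>y. (v y - 2 * d y) / (d y)\<^sup>2) differentiable (at x)" by (rule differentiableI)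
  show "(d x)\<^sup>2 * pderiv_at b (\<lambda>y. (v y - 2 * d y) / (d y)\<^sup>2) x
      = v' b - 2 * d' b - 2 * ((v x - 2 * d x) / d x) * d' b"
    unfolding pderiv_at_eqI[OF D] using \<open>d x > 0\<close>
    by (simp add: power2_eq_square divide_simps) (simp add: algebra_simps)
qed

theorem theorem1p2:
  fixes \<Omega> :: "(real ^ 'n) set" and \<alpha> :: real and v d w :: "real ^ 'n \<Rightarrow> real"
  assumes "CARD('n) \<ge> 3" and "0 < \<alpha>" and "\<alpha> < 1"
    and "bounded_domain_of_class 2 \<alpha> \<Omega>"
    and "hyperbolic_radius \<Omega> v"
    and "\<And>x. d x = infdist x (frontier \<Omega>)"
    and "\<And>x. w x = (v x - 2 * d x) / (d x)\<^sup>2"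
  shows "\<exists>\<delta>>0.
    bounded (w ` {x \<in> \<Omega>. 0 < d x \<and> d x < \<delta>}) \<and>
    (\<forall>x\<in>{x \<in> \<Omega>. 0 < d x \<and> d x < \<delta>}. w differentiable (at x)) \<and>
    bounded ((\<lambda>x. (d x)\<^sup>2 *\<^sub>R gradient w x) ` {x \<in> \<Omega>. 0 < d x \<and> d x < \<delta>})"
proof -
  have dim: "DIM(real ^ 'n) \<ge> 3" using assms(1) by simp
  have \<Omega>: "open \<Omega>" "bounded \<Omega>" "\<Omega> \<noteq> {}"
    using assms(4) by (auto simp: bounded_domain_of_class_def)
  have "\<Omega> \<noteq> UNIV" using \<Omega>(2) by auto
  then have "frontier \<Omega> \<noteq> {}" using \<Omega>(3) frontier_eq_empty by blast
  obtain R where R: "R > 0" "\<And>q. q \<in> frontier \<Omega> \<Longrightarrow> \<exists>\<nu>. two_sided_ball \<Omega> R q \<nu>"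
    using uniform_two_sided_ball[OF assms(4)] assms(2) by (metis less_imp_le)
  have d: "d = (\<lambda>x. infdist x (frontier \<Omega>))" using assms(6) by auto
  have w: "w = (\<lambda>x. (v x - 2 * d x) / (d x)\<^sup>2)" using assms(7) by auto
  obtain C where C: "\<And>x. x \<in> \<Omega> \<Longrightarrow> 0 < d x \<Longrightarrow> d x < R / 2 \<Longrightarrow>
      \<bar>v x - 2 * d x\<bar> \<le> (d x)\<^sup>2 / R \<and>
      (\<exists>d'. (d has_derivative d') (at x) \<and> (\<forall>b\<in>Basis. \<bar>d' b\<bar> \<le> 1)) \<and>
      (\<exists>v'. (v has_derivative v') (at x) \<and> (\<forall>b\<in>Basis. \<bar>v' b\<bar> \<le> C))"
    using hyperbolic_radius_near_frontier[OF dim \<Omega>(1) \<open>frontier \<Omega> \<noteq> {}\<close> R assms(5) d] by blast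
  define S where "S = {x \<in> \<Omega>. 0 < d x \<and> d x < R / 2}"
  have bound_w: "\<bar>w x\<bar> \<le> 1 / R" if "x \<in> S" for x
  proof -
    have "\<bar>v x - 2 * d x\<bar> \<le> (d x)\<^sup>2 / R" "d x > 0" using C[of x] that by (auto simp: S_def)
    then show ?thesis unfolding w by (simp add: abs_div divide_le_eq mult.commute)
  qed
  have grad: "w differentiable (at x) \<and> norm ((d x)\<^sup>2 *\<^sub>R gradient w x) \<le> real DIM(real ^ 'n) * (C + 3)"
    if "x \<in> S" for x
  proof -
    have x: "x \<in> \<Omega>" "0 < d x" "d x < R / 2" using that by (auto simp: S_def)
    obtain d' v' where d': "(d has_derivative d') (at x)" "\<And>b. b \<in> Basis \<Longrightarrow> \<bar>d' b\<bar> \<le> 1"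
      and v': "(v has_derivative v') (at x)" "\<And>b. b \<in> Basis \<Longrightarrow> \<bar>v' b\<bar> \<le> C"
      using C[OF x] by blast
    note deriv = pderiv_at_weighted_difference[OF v'(1) d'(1) x(2), folded w]
    have "\<bar>(v x - 2 * d x) / d x\<bar> \<le> d x / R"
      using C[OF x] x(2) by (simp add: abs_div divide_le_eq power2_eq_square)
    also have "\<dots> \<le> 1 / 2" using x R(1) by (simp add: divide_le_eq)
    finally have q: "\<bar>(v x - 2 * d x) / d x\<bar> \<le> 1 / 2" .
    have "\<bar>(d x)\<^sup>2 * pderiv_at b w x\<bar> \<le> C + 3" if b: "b \<in> Basis" for b
    proof -
      have "\<bar>(v x - 2 * d x) / d x\<bar> * \<bar>d' b\<bar> \<le> 1 / 2 * 1"
        using q d'(2)[OF b] by (intro mult_mono) auto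
      then have "\<bar>(v x - 2 * d x) / d x * d' b\<bar> \<le> 1 / 2" unfolding abs_mult by simp
      moreover have "(d x)\<^sup>2 * pderiv_at b w x = v' b - 2 * d' b - 2 * ((v x - 2 * d x) / d x * d' b)"
        using deriv(2)[of b] by (simp only: mult.assoc)
      ultimately show ?thesis using d'(2)[OF b] v'(2)[OF b] by linarith
    qed
    then show ?thesis using deriv(1) by (intro conjI norm_gradient_le)
  qed
  have "bounded (w ` S)" using bound_w unfolding bounded_iff by auto
  moreover have "bounded ((\<lambda>x. (d x)\<^sup>2 *\<^sub>R gradient w x) ` S)" using grad unfolding bounded_iff by blast
  ultimately show ?thesis
    using grad R(1) unfolding S_def by (intro exI[of _ "R / 2"]) auto
qed

end
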